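(* If $\kappa$ is a cardinal and $V_\kappa\prec M$ for some transitive set $M$ with $V_{\kappa+1}\subseteq M$, then $\kappa$ is neither first-order nor second-order theory categorical.
   Context: $V_\kappa$ is the rank-initial segment of the cumulative hierarchy, and $\prec$ denotes first-order elementary substructure in the language $\{\in\}$. A cardinal $\kappa$ is first-order (resp. second-order) theory categorical if $\kappa$ is inaccessible and there is a first-order (resp. second-order, with second-order quantifiers over all subsets of $V_\kappa$) theory $T$ with $V_\kappa\models T$ and $V_\lambda\not\models T$ for every inaccessible $\lambda\neq\kappa$. *)

theory Defs
  imports Main "HOL-Library.Equipollence" "HOL-Library.Countable_Set"
begin

text \<open>
  The ambient set-theoretic universe is a type satisfying the axioms of ZFC, with replacement
  for arbitrary HOL functions and foundation for arbitrary HOL predicates. Separation and choice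
  follow from replacement and from Hilbert choice respectively. Consequently every HOL subset of
  a set, and every HOL function between sets, is (the extension of) a set.
\<close>

class zfc =
  fixes elts :: "'a \<Rightarrow> 'a set"
  assumes extensionality: "elts x = elts y \<Longrightarrow> x = y"
    and foundation: "wf {(x, y). x \<in> elts y}"
    and pairing: "\<exists>z. elts z = {x, y}"
    and union: "\<exists>z. elts z = (\<Union>y\<in>elts x. elts y)"
    and powerset: "\<exists>z. elts z = {y. elts y \<subseteq> elts x}"
    and replacement: "\<exists>z. elts z = f ` elts x"
    and infinity: "\<exists>w. (\<exists>z\<in>elts w. elts z = {}) \<and>
                       (\<forall>x\<in>elts w. \<exists>y\<in>elts w. elts y = insert x (elts x))"

text \<open>Unspecified when \<^term>\<open>X\<close> is a proper class.\<close>
definition set_of :: "'v::zfc set \<Rightarrow> 'v"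
  where "set_of X = (THE x. elts x = X)"

definition small :: "'v::zfc set \<Rightarrow> bool"
  where "small X \<longleftrightarrow> (\<exists>x. elts x = X)"

lemma elts_set_of: "small X \<Longrightarrow> elts (set_of X) = X"
proof -
  assume "small X"
  then obtain x where x: "elts x = X" unfolding small_def ..
  have "set_of X = x"
    unfolding set_of_def by (rule the_equality) (simp_all add: x extensionality)
  then show ?thesis using x by simp
qed

lemma small_elts: "small (elts x)"
  by (auto simp: small_def)

lemma small_image: "small X \<Longrightarrow> small (f ` X)" for f :: "'v::zfc \<Rightarrow> 'v"
proof -
  assume "small X"
  then obtain x where x: "elts x = X" unfolding small_def ..
  show ?thesis unfolding small_def x[symmetric] by (rule replacement)
qed

lemma small_subset:
  assumes "small X" "Y \<subseteq> X" shows "small Y"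
proof (cases "Y = {}")
  case True
  then show ?thesis using infinity by (auto simp: small_def)
next
  case False
  then obtain a where "a \<in> Y" by blast
  then have "Y = (\<lambda>x. if x \<in> Y then x else a) ` X" using assms(2) by auto
  then show ?thesis using small_image[OF assms(1)] by metis
qed

lemma small_UN:
  fixes F :: "'v::zfc \<Rightarrow> 'v set"
  assumes "small X" "\<And>x. x \<in> X \<Longrightarrow> small (F x)" shows "small (\<Union>x\<in>X. F x)"
proof -
  obtain z where z: "elts z = (\<lambda>x. set_of (F x)) ` X"
    using small_image[OF assms(1)] unfolding small_def by blast
  obtain u where "elts u = (\<Union>y\<in>elts z. elts y)" using union by blast
  also have "\<dots> = (\<Union>x\<in>X. F x)" using assms(2) by (simp add: z elts_set_of)
  finally show ?thesis by (auto simp: small_def)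
qed

lemma small_insert:
  assumes "small X" shows "small (insert a X)"
proof -
  obtain x where x: "elts x = X" using assms by (auto simp: small_def)
  obtain s where s: "elts s = {a}" using pairing[of a a] by auto
  obtain p where p: "elts p = {s, x}" using pairing by blast
  obtain u where "elts u = (\<Union>y\<in>elts p. elts y)" using union by blast
  then have "elts u = insert a X" by (simp add: p s x)
  then show ?thesis by (auto simp: small_def)
qed


definition Transset :: "'v::zfc \<Rightarrow> bool"
  where "Transset x \<longleftrightarrow> (\<forall>y\<in>elts x. elts y \<subseteq> elts x)"

definition Ord :: "'v::zfc \<Rightarrow> bool"
  where "Ord \<alpha> \<longleftrightarrow> Transset \<alpha> \<and> (\<forall>x\<in>elts \<alpha>. Transset x)"

definition succ :: "'v::zfc \<Rightarrow> 'v"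
  where "succ \<alpha> = set_of (insert \<alpha> (elts \<alpha>))"

lemma elts_succ: "elts (succ \<alpha>) = insert \<alpha> (elts \<alpha>)"
  by (simp add: succ_def elts_set_of small_insert small_elts)

definition Card :: "'v::zfc \<Rightarrow> bool"
  where "Card \<kappa> \<longleftrightarrow> Ord \<kappa> \<and> (\<forall>\<alpha>\<in>elts \<kappa>. \<not> elts \<alpha> \<approx> elts \<kappa>)"

definition regular :: "'v::zfc \<Rightarrow> bool"
  where "regular \<kappa> \<longleftrightarrow> Card \<kappa> \<and> infinite (elts \<kappa>) \<and>
    (\<forall>X\<subseteq>elts \<kappa>. X \<prec> elts \<kappa> \<longrightarrow> (\<exists>\<beta>\<in>elts \<kappa>. X \<subseteq> elts \<beta>))"

definition strong_limit :: "'v::zfc \<Rightarrow> bool"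
  where "strong_limit \<kappa> \<longleftrightarrow> Card \<kappa> \<and> (\<forall>\<alpha>\<in>elts \<kappa>. Pow (elts \<alpha>) \<prec> elts \<kappa>)"

definition inaccessible :: "'v::zfc \<Rightarrow> bool"
  where "inaccessible \<kappa> \<longleftrightarrow> uncountable (elts \<kappa>) \<and> regular \<kappa> \<and> strong_limit \<kappa>"

text \<open>The cumulative hierarchy: \<open>V\<^sub>\<alpha>\<close> is the union of the power sets of the \<open>V\<^sub>\<beta>\<close>, \<open>\<beta> \<in> \<alpha>\<close>.\<close>
function Vset :: "'v::zfc \<Rightarrow> 'v"
  where "Vset \<alpha> = set_of (\<Union>\<beta>\<in>elts \<alpha>. {x. elts x \<subseteq> elts (Vset \<beta>)})"
  by auto
termination
  by (relation "{(x, y). x \<in> elts y}") (simp_all add: foundation)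

declare Vset.simps [simp del]

lemma elts_Vset: "elts (Vset \<alpha>) = (\<Union>\<beta>\<in>elts \<alpha>. {x. elts x \<subseteq> elts (Vset \<beta>)})"
proof -
  have "small {x. elts x \<subseteq> elts (Vset \<beta>)}" for \<beta> :: 'a
    using powerset by (auto simp: small_def)
  then show ?thesis
    by (subst Vset.simps) (simp add: elts_set_of small_UN small_elts)
qed


text \<open>First-order formulas in the language of set theory; variables are natural numbers.\<close>
datatype fm =
    Mem nat nat
  | Eq nat nat
  | Neg fm
  | And fm fm
  | All nat fm

primrec fv :: "fm \<Rightarrow> nat set" where
  "fv (Mem i j) = {i, j}"
| "fv (Eq i j) = {i, j}"
| "fv (Neg p) = fv p"
| "fv (And p q) = fv p \<union> fv q"
| "fv (All i p) = fv p - {i}"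

primrec sat :: "'v::zfc \<Rightarrow> (nat \<Rightarrow> 'v) \<Rightarrow> fm \<Rightarrow> bool" where
  "sat M e (Mem i j) \<longleftrightarrow> e i \<in> elts (e j)"
| "sat M e (Eq i j) \<longleftrightarrow> e i = e j"
| "sat M e (Neg p) \<longleftrightarrow> \<not> sat M e p"
| "sat M e (And p q) \<longleftrightarrow> sat M e p \<and> sat M e q"
| "sat M e (All i p) \<longleftrightarrow> (\<forall>a\<in>elts M. sat M (e(i := a)) p)"

definition elem_substructure :: "'v::zfc \<Rightarrow> 'v \<Rightarrow> bool"
  where "elem_substructure N M \<longleftrightarrow> elts N \<subseteq> elts M \<and>
    (\<forall>p e. e ` fv p \<subseteq> elts N \<longrightarrow> (sat N e p \<longleftrightarrow> sat M e p))"

definition fo_theory :: "fm set \<Rightarrow> bool"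
  where "fo_theory T \<longleftrightarrow> (\<forall>p\<in>T. fv p = {})"

text \<open>For sentences the truth value does not depend on the assignment.\<close>
definition fo_models :: "'v::zfc \<Rightarrow> fm set \<Rightarrow> bool"
  where "fo_models M T \<longleftrightarrow> (\<forall>p\<in>T. \<forall>e. sat M e p)"

text \<open>
  Second-order formulas, with separate first-order and (unary) second-order variables.
  \<open>MemC2 i j\<close> says that the individual \<open>i\<close> belongs to the class \<open>j\<close>.
\<close>
datatype fm2 =
    Mem2 nat nat
  | Eq2 nat nat
  | MemC2 nat nat
  | Neg2 fm2
  | And2 fm2 fm2
  | All2 nat fm2
  | AllC2 nat fm2

primrec fv2 :: "fm2 \<Rightarrow> nat set" where
  "fv2 (Mem2 i j) = {i, j}"
| "fv2 (Eq2 i j) = {i, j}"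
| "fv2 (MemC2 i j) = {i}"
| "fv2 (Neg2 p) = fv2 p"
| "fv2 (And2 p q) = fv2 p \<union> fv2 q"
| "fv2 (All2 i p) = fv2 p - {i}"
| "fv2 (AllC2 j p) = fv2 p"

primrec fvC2 :: "fm2 \<Rightarrow> nat set" where
  "fvC2 (Mem2 i j) = {}"
| "fvC2 (Eq2 i j) = {}"
| "fvC2 (MemC2 i j) = {j}"
| "fvC2 (Neg2 p) = fvC2 p"
| "fvC2 (And2 p q) = fvC2 p \<union> fvC2 q"
| "fvC2 (All2 i p) = fvC2 p"
| "fvC2 (AllC2 j p) = fvC2 p - {j}"

primrec sat2 :: "'v::zfc \<Rightarrow> (nat \<Rightarrow> 'v) \<Rightarrow> (nat \<Rightarrow> 'v set) \<Rightarrow> fm2 \<Rightarrow> bool" where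
  "sat2 M e E (Mem2 i j) \<longleftrightarrow> e i \<in> elts (e j)"
| "sat2 M e E (Eq2 i j) \<longleftrightarrow> e i = e j"
| "sat2 M e E (MemC2 i j) \<longleftrightarrow> e i \<in> E j"
| "sat2 M e E (Neg2 p) \<longleftrightarrow> \<not> sat2 M e E p"
| "sat2 M e E (And2 p q) \<longleftrightarrow> sat2 M e E p \<and> sat2 M e E q"
| "sat2 M e E (All2 i p) \<longleftrightarrow> (\<forall>a\<in>elts M. sat2 M (e(i := a)) E p)"
| "sat2 M e E (AllC2 j p) \<longleftrightarrow> (\<forall>A\<subseteq>elts M. sat2 M e (E(j := A)) p)"

definition so_theory :: "fm2 set \<Rightarrow> bool"
  where "so_theory T \<longleftrightarrow> (\<forall>p\<in>T. fv2 p = {} \<and> fvC2 p = {})"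

definition so_models :: "'v::zfc \<Rightarrow> fm2 set \<Rightarrow> bool"
  where "so_models M T \<longleftrightarrow> (\<forall>p\<in>T. \<forall>e E. sat2 M e E p)"


definition fo_theory_categorical :: "'v::zfc \<Rightarrow> bool"
  where "fo_theory_categorical \<kappa> \<longleftrightarrow> inaccessible \<kappa> \<and>
    (\<exists>T. fo_theory T \<and> fo_models (Vset \<kappa>) T \<and>
      (\<forall>\<mu>. inaccessible \<mu> \<and> \<mu> \<noteq> \<kappa> \<longrightarrow> \<not> fo_models (Vset \<mu>) T))"

definition so_theory_categorical :: "'v::zfc \<Rightarrow> bool"
  where "so_theory_categorical \<kappa> \<longleftrightarrow> inaccessible \<kappa> \<and>
    (\<exists>T. so_theory T \<and> so_models (Vset \<kappa>) T \<and>
      (\<forall>\<mu>. inaccessible \<mu> \<and> \<mu> \<noteq> \<kappa> \<longrightarrow> \<not> so_models (Vset \<mu>) T))"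

end

theory Submission
  imports Defs
begin

text \<open>
  A theory categorical for \<open>\<kappa>\<close> is, suitably coded, an element \<open>t\<close> of \<open>V\<^sub>\<kappa>\<close>. Since \<open>V\<^sub>\<kappa>\<close> has a
  satisfaction class for each of its \<open>V\<^sub>\<delta>\<close> with \<open>\<delta>\<close> inaccessible, so does \<open>M\<close>, in particular for
  \<open>V\<^sub>\<kappa>\<close>. Hence \<open>M\<close> believes that some inaccessible \<open>\<delta>\<close> has \<open>V\<^sub>\<delta> \<Turnstile> t\<close>, and by elementarity so does
  \<open>V\<^sub>\<kappa>\<close>. Inaccessibility, being \<open>V\<^sub>\<delta>\<close>, and second-order satisfaction only quantify over subsets of
  \<open>V\<^sub>\<delta>\<close>, all of which lie in \<open>M\<close> (for \<open>\<delta> = \<kappa>\<close>) or in \<open>V\<^sub>\<kappa>\<close> (for \<open>\<delta> < \<kappa>\<close>), so the statement is absolute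
  and contradicts categoricity. To keep satisfaction at this level, an assignment is coded by a
  single set \<open>F \<subseteq> V\<^sub>\<delta>\<close>, where variable \<open>i\<close> has the value \<open>{x. \<langle>i, x\<rangle> \<in> F}\<close>; individuals are coded by
  singletons.
\<close>

section \<open>Basic set theory\<close>

lemma elts_induct [case_names step]:
  fixes x :: "'v::zfc"
  assumes "\<And>x. (\<And>y. y \<in> elts x \<Longrightarrow> P y) \<Longrightarrow> P x"
  shows "P x"
  using foundation by (rule wf_induct_rule) (use assms in auto)

lemma elts_irrefl: "x \<notin> elts (x::'v::zfc)"
  using wf_irrefl[OF foundation, of x] by auto

lemma small_empty: "small ({} :: 'v::zfc set)"
  by (rule small_subset[OF small_elts]) simp

section \<open>Kuratowski pairs and power sets\<close>

definition vpair :: "'v::zfc \<Rightarrow> 'v \<Rightarrow> 'v"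
  where "vpair a b = set_of {set_of {a}, set_of {a, b}}"

lemma small_finite: "finite X \<Longrightarrow> small (X :: 'v::zfc set)"
  by (induction rule: finite_induct) (auto intro: small_empty small_insert)

lemma elts_finite [simp]: "finite X \<Longrightarrow> elts (set_of X) = (X :: 'v::zfc set)"
  by (simp add: elts_set_of small_finite)

lemma set_of_eq_iff: "small X \<Longrightarrow> x = set_of X \<longleftrightarrow> elts x = (X :: 'v::zfc set)"
  by (metis elts_set_of extensionality)

lemma elts_vpair: "elts (vpair a b) = {set_of {a}, set_of {a, b}}"
  by (simp add: vpair_def)

lemma set_of_finite_inject [simp]:
  "finite X \<Longrightarrow> finite Y \<Longrightarrow> set_of X = set_of Y \<longleftrightarrow> X = (Y :: 'v::zfc set)"
  by (metis elts_finite)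

lemma vpair_inject [simp]: "vpair a b = vpair c d \<longleftrightarrow> a = c \<and> b = (d :: 'v::zfc)"
  unfolding vpair_def by (auto simp: doubleton_eq_iff)

lemma vpair_components_in_Transset:
  assumes "Transset M" "vpair a b \<in> elts M" shows "a \<in> elts M" "b \<in> elts M"
proof -
  have "set_of {a, b} \<in> elts M" using assms by (auto simp: Transset_def elts_vpair)
  then have "elts (set_of {a, b}) \<subseteq> elts M" using assms(1) by (auto simp only: Transset_def)
  then show "a \<in> elts M" "b \<in> elts M" by simp_all
qed

definition vpow :: "'v::zfc \<Rightarrow> 'v" where "vpow x = set_of {y. elts y \<subseteq> elts x}"

lemma elts_vpow [simp]: "elts (vpow x) = {y. elts y \<subseteq> elts x}"
  unfolding vpow_def by (rule elts_set_of) (use powerset in \<open>auto simp: small_def\<close>)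

section \<open>The cumulative hierarchy and its limit levels\<close>

lemma Vset_iff: "x \<in> elts (Vset \<alpha>) \<longleftrightarrow> (\<exists>\<beta>\<in>elts \<alpha>. elts x \<subseteq> elts (Vset \<beta>))"
  by (subst elts_Vset) auto

lemma VsetI: "\<beta> \<in> elts \<alpha> \<Longrightarrow> elts x \<subseteq> elts (Vset \<beta>) \<Longrightarrow> x \<in> elts (Vset \<alpha>)"
  using Vset_iff by blast

lemma VsetE:
  assumes "x \<in> elts (Vset \<alpha>)"
  obtains \<beta> where "\<beta> \<in> elts \<alpha>" "elts x \<subseteq> elts (Vset \<beta>)"
  using assms Vset_iff by blast

lemma Transset_Vset: "Transset (Vset \<alpha>)"
proof (induction \<alpha> rule: elts_induct)
  case (step \<alpha>)
  show ?case unfolding Transset_def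
  proof (intro ballI subsetI)
    fix x y assume "x \<in> elts (Vset \<alpha>)" "y \<in> elts x"
    then obtain \<beta> where "\<beta> \<in> elts \<alpha>" "y \<in> elts (Vset \<beta>)" by (meson VsetE subsetD)
    then show "y \<in> elts (Vset \<alpha>)" using step by (meson Transset_def VsetI)
  qed
qed

lemma Vset_subset: "\<beta> \<in> elts \<alpha> \<Longrightarrow> elts (Vset \<beta>) \<subseteq> elts (Vset \<alpha>)"
  using Transset_Vset[of \<beta>] by (meson Transset_def VsetI subsetI)

lemma elts_subset_Vset: "elts \<alpha> \<subseteq> elts (Vset \<alpha>)"
proof (induction \<alpha> rule: elts_induct)
  case (step \<alpha>)
  then show ?case by (meson VsetI subsetI)
qed

text \<open>For an ordinal this says that it is zero or a limit. This form avoids comparability of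
  ordinals and directly supplies the common bound behind closure of \<open>V\<^sub>\<delta>\<close>
  under pairs and power sets.\<close>

definition directed :: "'v::zfc \<Rightarrow> bool"
  where "directed \<delta> \<longleftrightarrow> (\<forall>\<alpha>\<in>elts \<delta>. \<forall>\<beta>\<in>elts \<delta>. \<exists>\<gamma>\<in>elts \<delta>. \<alpha> \<in> elts \<gamma> \<and> \<beta> \<in> elts \<gamma>)"

lemma Vset_directed_finite:
  assumes "directed \<delta>" "x \<in> elts (Vset \<delta>)" "y \<in> elts (Vset \<delta>)"
  shows "set_of {x, y} \<in> elts (Vset \<delta>)"
proof -
  obtain \<alpha> \<beta> where ab: "\<alpha> \<in> elts \<delta>" "\<beta> \<in> elts \<delta>" "elts x \<subseteq> elts (Vset \<alpha>)" "elts y \<subseteq> elts (Vset \<beta>)"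
    using assms(2-) by (meson VsetE)
  then obtain \<gamma> where "\<gamma> \<in> elts \<delta>" "\<alpha> \<in> elts \<gamma>" "\<beta> \<in> elts \<gamma>"
    using assms(1) unfolding directed_def by blast
  then have "elts (set_of {x, y}) \<subseteq> elts (Vset \<gamma>)" using ab by (simp add: VsetI)
  then show ?thesis using \<open>\<gamma> \<in> elts \<delta>\<close> by (meson VsetI)
qed

lemma Vset_directed_vpair:
  assumes "directed \<delta>" "x \<in> elts (Vset \<delta>)" "y \<in> elts (Vset \<delta>)"
  shows "vpair x y \<in> elts (Vset \<delta>)"
  using Vset_directed_finite[OF assms(1)] assms(2,3) unfolding vpair_def
  by (metis insert_absorb2)

lemma Vset_directed_vpow:
  assumes "directed \<delta>" "x \<in> elts (Vset \<delta>)"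
  shows "vpow x \<in> elts (Vset \<delta>)"
proof -
  obtain \<alpha> where a: "\<alpha> \<in> elts \<delta>" "elts x \<subseteq> elts (Vset \<alpha>)"
    using assms(2-) by (meson VsetE)
  then obtain \<gamma> where "\<gamma> \<in> elts \<delta>" "\<alpha> \<in> elts \<gamma>"
    using assms(1) unfolding directed_def by blast
  then have "elts (vpow x) \<subseteq> elts (Vset \<gamma>)" using a by (auto intro!: VsetI[of \<alpha> \<gamma>])
  then show ?thesis using \<open>\<gamma> \<in> elts \<delta>\<close> by (meson VsetI)
qed

lemma Vset_downward: "x \<in> elts (Vset \<delta>) \<Longrightarrow> elts y \<subseteq> elts x \<Longrightarrow> y \<in> elts (Vset \<delta>)"
  by (meson VsetE VsetI subset_trans)

section \<open>Natural numbers and countable sets\<close>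

primrec vnat :: "nat \<Rightarrow> 'v::zfc" where
  "vnat 0 = set_of {}"
| "vnat (Suc n) = succ (vnat n)"

declare vnat.simps [simp del]

lemma vnat_mem: "m < n \<Longrightarrow> vnat m \<in> elts (vnat n :: 'v::zfc)"
  by (induction n) (auto simp: vnat.simps elts_succ less_Suc_eq)

lemma vnat_inject [simp]: "vnat m = (vnat n :: 'v::zfc) \<longleftrightarrow> m = n"
  by (metis vnat_mem elts_irrefl linorder_neqE_nat)

text \<open>Infinity gives a set containing every \<open>vnat n\<close>, so their range is small;
  replacement along \<open>inv vnat\<close> carries this over to the range of
  \<open>g\<close>.\<close>

lemma small_range_nat: "small (range (g :: nat \<Rightarrow> 'v::zfc))"
proof -
  obtain w :: 'v where *: "\<exists>z\<in>elts w. elts z = {}"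
      "\<forall>x\<in>elts w. \<exists>y\<in>elts w. elts y = insert x (elts x)"
    using infinity by metis
  then obtain z where w: "z \<in> elts w" "elts z = {}" by auto
  have "vnat n \<in> elts w" for n
  proof (induction n)
    case 0
    have "z = vnat 0" using w(2) by (intro extensionality) (simp add: vnat.simps)
    then show ?case using w(1) by simp
  next
    case (Suc n)
    then obtain y where "y \<in> elts w" "elts y = elts (succ (vnat n))"
      using *(2) unfolding elts_succ by auto
    then show ?case using extensionality by (auto simp: vnat.simps)
  qed
  then have "small (range (vnat :: nat \<Rightarrow> 'v))"
    by (intro small_subset[OF small_elts[of w]]) auto
  then have "small ((\<lambda>x. g (inv vnat x)) ` range (vnat :: nat \<Rightarrow> 'v))" by (rule small_image)
  moreover have "inj (vnat :: nat \<Rightarrow> 'v)" by (simp add: inj_def)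
  ultimately show ?thesis by (simp add: image_image inv_f_f)
qed

lemma small_countable: "countable X \<Longrightarrow> small (X :: 'v::zfc set)"
  by (metis small_empty small_range_nat range_from_nat_into)

section \<open>Inaccessible cardinals\<close>

lemma lesspoll_iff: "X \<prec> Y \<longleftrightarrow> X \<lesssim> Y \<and> \<not> Y \<lesssim> X"
  unfolding lesspoll_def by (meson eqpoll_imp_lepoll eqpoll_sym lepoll_antisym)

lemma inaccessible_bounded_countable:
  assumes "inaccessible \<kappa>" "countable Y" "Y \<subseteq> elts \<kappa>"
  shows "\<exists>\<beta>\<in>elts \<kappa>. Y \<subseteq> elts \<beta>"
proof -
  have "\<not> elts \<kappa> \<lesssim> Y"
    using assms(1,2) countable_lepoll unfolding inaccessible_def by blast
  then have "Y \<prec> elts \<kappa>" using assms(3) by (simp add: lesspoll_iff subset_imp_lepoll)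
  then show ?thesis using assms unfolding inaccessible_def regular_def by blast
qed

lemma inaccessible_directed: "inaccessible \<kappa> \<Longrightarrow> directed \<kappa>"
  unfolding directed_def
proof (intro ballI)
  fix \<alpha> \<beta> assume "inaccessible \<kappa>" "\<alpha> \<in> elts \<kappa>" "\<beta> \<in> elts \<kappa>"
  then show "\<exists>\<gamma>\<in>elts \<kappa>. \<alpha> \<in> elts \<gamma> \<and> \<beta> \<in> elts \<gamma>"
    using inaccessible_bounded_countable[of \<kappa> "{\<alpha>, \<beta>}"] by auto
qed

text \<open>Each element of \<open>Y\<close> is a subset of some earlier level. Countably many
  levels are bounded below \<kappa>, by regularity and uncountability, so all of \<open>Y\<close>
  lies in a single earlier level.\<close>

lemma Vset_inaccessible_countable:
  assumes "inaccessible \<kappa>" "countable Y" "Y \<subseteq> elts (Vset \<kappa>)"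
  shows "set_of Y \<in> elts (Vset \<kappa>)"
proof -
  obtain f where f: "\<And>y. y \<in> Y \<Longrightarrow> f y \<in> elts \<kappa> \<and> elts y \<subseteq> elts (Vset (f y))"
    using assms(3) by (metis VsetE subsetD)
  then obtain \<beta> where b: "\<beta> \<in> elts \<kappa>" "f ` Y \<subseteq> elts \<beta>"
    using inaccessible_bounded_countable[OF assms(1), of "f ` Y"] assms(2) by auto
  then have "Y \<subseteq> elts (Vset \<beta>)" using f by (meson VsetI image_subset_iff subsetI)
  then have "elts (set_of Y) \<subseteq> elts (Vset \<beta>)"
    using assms(2) by (simp add: elts_set_of small_countable)
  then show ?thesis using b by (meson VsetI)
qed

lemma vnat_in_Vset:
  assumes "inaccessible \<kappa>" shows "vnat n \<in> elts (Vset \<kappa>)"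
proof (induction n)
  case 0
  show ?case using Vset_inaccessible_countable[OF assms, of "{}"] by (simp add: vnat.simps)
next
  case (Suc n)
  have "elts (vnat (Suc n)) \<subseteq> elts (Vset \<kappa>)" "countable (elts (vnat (Suc n) :: 'a))"
  proof -
    show "elts (vnat (Suc n)) \<subseteq> elts (Vset \<kappa>)"
      using Suc Transset_Vset[of \<kappa>] by (auto simp: vnat.simps elts_succ Transset_def)
    have "finite (elts (vnat m :: 'a))" for m by (induction m) (auto simp: vnat.simps elts_succ)
    then show "countable (elts (vnat (Suc n) :: 'a))" by (rule countable_finite)
  qed
  then have "set_of (elts (vnat (Suc n))) \<in> elts (Vset \<kappa>)"
    using Vset_inaccessible_countable[OF assms] by blast
  then show ?case by (metis set_of_eq_iff small_elts)
qed

text \<open>Prepares the translation into a formula: all comparisons of size become embeddings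
  between extensions of sets, with uncountability measured against one fixed countably infinite
  \<open>N\<close> and \<open>vpow\<close> replacing \<open>Pow\<close>.\<close>

lemma inaccessible_iff:
  fixes \<delta> :: "'v::zfc"
  assumes "countable N" "infinite N"
  shows "inaccessible \<delta> \<longleftrightarrow> Ord \<delta> \<and> \<not> elts \<delta> \<lesssim> N \<and> (\<forall>\<alpha>\<in>elts \<delta>. \<not> elts \<delta> \<lesssim> elts \<alpha>) \<and>
    (\<forall>Y. elts Y \<subseteq> elts \<delta> \<and> \<not> elts \<delta> \<lesssim> elts Y \<longrightarrow> (\<exists>\<beta>\<in>elts \<delta>. elts Y \<subseteq> elts \<beta>)) \<and>
    (\<forall>\<alpha>\<in>elts \<delta>. elts (vpow \<alpha>) \<lesssim> elts \<delta> \<and> \<not> elts \<delta> \<lesssim> elts (vpow \<alpha>))"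
proof -
  have unc: "uncountable (elts \<delta>) \<longleftrightarrow> \<not> elts \<delta> \<lesssim> N"
  proof
    assume "\<not> elts \<delta> \<lesssim> N"
    moreover have "N \<approx> (UNIV :: nat set)"
      using assms by (metis eqpoll_def to_nat_on_infinite)
    ultimately show "uncountable (elts \<delta>)"
      by (metis bij_betw_imp_inj_on countableE lepoll_def lepoll_trans2 eqpoll_sym top_greatest)
  next
    assume "uncountable (elts \<delta>)"
    then show "\<not> elts \<delta> \<lesssim> N" using assms(1) countable_lepoll by blast
  qed
  have card: "Card \<delta> \<longleftrightarrow> Ord \<delta> \<and> (\<forall>\<alpha>\<in>elts \<delta>. \<not> elts \<delta> \<lesssim> elts \<alpha>)"
  proof -
    \<comment> \<open>Elements of an ordinal are subsets of it, so by Schroeder-Bernstein one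
      embedding already gives equipollence.\<close>
    have "elts \<alpha> \<approx> elts \<delta> \<longleftrightarrow> elts \<delta> \<lesssim> elts \<alpha>" if "Ord \<delta>" "\<alpha> \<in> elts \<delta>" for \<alpha>
    proof -
      have "elts \<alpha> \<lesssim> elts \<delta>"
        using that by (auto simp: Ord_def Transset_def intro: subset_imp_lepoll)
      then show ?thesis by (meson eqpoll_imp_lepoll eqpoll_sym lepoll_antisym)
    qed
    then show ?thesis unfolding Card_def by blast
  qed
  have sub: "(\<forall>Z\<subseteq>elts \<delta>. Z \<prec> elts \<delta> \<longrightarrow> (\<exists>\<beta>\<in>elts \<delta>. Z \<subseteq> elts \<beta>)) \<longleftrightarrow>
    (\<forall>Y. elts Y \<subseteq> elts \<delta> \<and> \<not> elts \<delta> \<lesssim> elts Y \<longrightarrow> (\<exists>\<beta>\<in>elts \<delta>. elts Y \<subseteq> elts \<beta>))"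
    (is "?L \<longleftrightarrow> ?R")
  proof
    assume ?L
    then show ?R by (auto simp: lesspoll_iff intro: subset_imp_lepoll)
  next
    assume R: ?R
    show ?L
    proof (intro allI impI)
      fix Z assume Z: "Z \<subseteq> elts \<delta>" "Z \<prec> elts \<delta>"
      then have "elts (set_of Z) = Z" using elts_set_of small_elts small_subset by blast
      then show "\<exists>\<beta>\<in>elts \<delta>. Z \<subseteq> elts \<beta>" using R Z by (metis lesspoll_iff)
    qed
  qed
  have "elts (vpow \<alpha>) \<approx> Pow (elts \<alpha>)" for \<alpha> :: 'v
  proof -
    have "bij_betw elts (elts (vpow \<alpha>)) (Pow (elts \<alpha>))"
      unfolding bij_betw_def inj_on_def
      by (auto simp: extensionality image_iff) (metis elts_set_of small_elts small_subset)
    then show ?thesis by (auto simp: eqpoll_def)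
  qed
  then have "elts (vpow \<alpha>) \<lesssim> Z \<longleftrightarrow> Pow (elts \<alpha>) \<lesssim> Z"
      "Z \<lesssim> elts (vpow \<alpha>) \<longleftrightarrow> Z \<lesssim> Pow (elts \<alpha>)" for \<alpha> :: 'v and Z :: "'v set"
    by (meson eqpoll_sym lepoll_trans1 lepoll_trans2)+
  then have pw: "Pow (elts \<alpha>) \<prec> elts \<delta> \<longleftrightarrow> elts (vpow \<alpha>) \<lesssim> elts \<delta> \<and> \<not> elts \<delta> \<lesssim> elts (vpow \<alpha>)" for \<alpha> :: 'v
    unfolding lesspoll_iff by simp
  show ?thesis
    unfolding inaccessible_def regular_def strong_limit_def unc[symmetric] card sub pw
    using countable_finite[of "elts \<delta>"] by argo
qed

section \<open>Set-theoretic formulas and their absoluteness\<close>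

definition fEx :: "nat \<Rightarrow> fm \<Rightarrow> fm" where "fEx i p = Neg (All i (Neg p))"
definition fOr :: "fm \<Rightarrow> fm \<Rightarrow> fm" where "fOr p q = Neg (And (Neg p) (Neg q))"
definition fImp :: "fm \<Rightarrow> fm \<Rightarrow> fm" where "fImp p q = Neg (And p (Neg q))"
definition fIff :: "fm \<Rightarrow> fm \<Rightarrow> fm" where "fIff p q = And (fImp p q) (fImp q p)"

lemma sat_connectives [simp]:
  "sat M e (fEx i p) \<longleftrightarrow> (\<exists>a\<in>elts M. sat M (e(i := a)) p)"
  "sat M e (fOr p q) \<longleftrightarrow> sat M e p \<or> sat M e q"
  "sat M e (fImp p q) \<longleftrightarrow> (sat M e p \<longrightarrow> sat M e q)"
  "sat M e (fIff p q) \<longleftrightarrow> (sat M e p \<longleftrightarrow> sat M e q)"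
  by (auto simp: fEx_def fOr_def fImp_def fIff_def)

text \<open>Transitivity of \<open>M\<close> is bundled in, so that this one hypothesis makes
  quantifiers bounded by a value \<open>e i\<close> mean the same in \<open>M\<close> as in the
  universe.\<close>

definition env :: "'v::zfc \<Rightarrow> (nat \<Rightarrow> 'v) \<Rightarrow> bool"
  where "env M e \<longleftrightarrow> Transset M \<and> (\<forall>i. e i \<in> elts M)"

lemma env_upd [simp]: "env M e \<Longrightarrow> a \<in> elts M \<Longrightarrow> env M (e(i := a))"
  by (simp add: env_def)

lemma env_in: "env M e \<Longrightarrow> e i \<in> elts M"
  by (simp add: env_def)

lemma env_trans: "env M e \<Longrightarrow> x \<in> elts y \<Longrightarrow> y \<in> elts M \<Longrightarrow> x \<in> elts M"
  unfolding env_def Transset_def by blast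

lemma env_bounded:
  assumes "env M e"
  shows "(\<forall>a\<in>elts M. a \<in> elts (e i) \<longrightarrow> P a) \<longleftrightarrow> (\<forall>a\<in>elts (e i). P a)"
    "(\<exists>a\<in>elts M. a \<in> elts (e i) \<and> P a) \<longleftrightarrow> (\<exists>a\<in>elts (e i). P a)"
  using env_trans[OF assms] env_in[OF assms] by blast+

text \<open>Each formula below binds only variables smaller than those it may be applied to,
  so the side conditions exclude capture.\<close>

definition fSub :: "nat \<Rightarrow> nat \<Rightarrow> fm"
  where "fSub x y = All 0 (fImp (Mem 0 x) (Mem 0 y))"

lemma sat_fSub [simp]:
  "env M e \<Longrightarrow> 0 < x \<Longrightarrow> 0 < y \<Longrightarrow> sat M e (fSub x y) \<longleftrightarrow> elts (e x) \<subseteq> elts (e y)"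
  unfolding fSub_def using env_trans env_in by (auto, blast)

definition fUpair :: "nat \<Rightarrow> nat \<Rightarrow> nat \<Rightarrow> fm"
  where "fUpair z a b = All 0 (fIff (Mem 0 z) (fOr (Eq 0 a) (Eq 0 b)))"

lemma sat_fUpair [simp]:
  assumes "env M e" "0 < z" "0 < a" "0 < b"
  shows "sat M e (fUpair z a b) \<longleftrightarrow> e z = set_of {e a, e b}"
proof -
  have "sat M e (fUpair z a b) \<longleftrightarrow> (\<forall>x\<in>elts M. x \<in> elts (e z) \<longleftrightarrow> x = e a \<or> x = e b)"
    using assms by (simp add: fUpair_def)
  also have "\<dots> \<longleftrightarrow> elts (e z) = {e a, e b}"
    using env_trans[OF assms(1)] env_in[OF assms(1)] by blast
  finally show ?thesis by (simp add: set_of_eq_iff small_finite)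
qed

definition fPair :: "nat \<Rightarrow> nat \<Rightarrow> nat \<Rightarrow> fm"
  where "fPair z a b = And (fEx 1 (And (Mem 1 z) (fUpair 1 a a))) (And (fEx 1 (And (Mem 1 z) (fUpair 1 a b)))
     (All 1 (fImp (Mem 1 z) (fOr (fUpair 1 a a) (fUpair 1 a b)))))"

lemma sat_fPair [simp]:
  assumes "env M e" "1 < z" "1 < a" "1 < b"
  shows "sat M e (fPair z a b) \<longleftrightarrow> e z = vpair (e a) (e b)"
proof -
  have "sat M e (fPair z a b) \<longleftrightarrow> (\<exists>x\<in>elts M. x \<in> elts (e z) \<and> x = set_of {e a, e a}) \<and>
     (\<exists>x\<in>elts M. x \<in> elts (e z) \<and> x = set_of {e a, e b}) \<and>
     (\<forall>x\<in>elts M. x \<in> elts (e z) \<longrightarrow> x = set_of {e a, e a} \<or> x = set_of {e a, e b})"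
    using assms unfolding fPair_def
    by (simp cong: ball_cong bex_cong)
  also have "\<dots> \<longleftrightarrow> elts (e z) = {set_of {e a, e a}, set_of {e a, e b}}"
    using env_trans[OF assms(1)] env_in[OF assms(1)] by blast
  finally show ?thesis by (simp add: vpair_def set_of_eq_iff small_finite)
qed

definition fIn :: "nat \<Rightarrow> nat \<Rightarrow> nat \<Rightarrow> fm"
  where "fIn a b F = fEx 2 (And (Mem 2 F) (fPair 2 a b))"

lemma sat_fIn [simp]:
  assumes "env M e" "2 < F" "2 < a" "2 < b"
  shows "sat M e (fIn a b F) \<longleftrightarrow> vpair (e a) (e b) \<in> elts (e F)"
proof -
  have "sat M e (fIn a b F) \<longleftrightarrow> (\<exists>x\<in>elts M. x \<in> elts (e F) \<and> x = vpair (e a) (e b))"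
    using assms unfolding fIn_def by (simp cong: ball_cong bex_cong)
  then show ?thesis using env_trans[OF assms(1)] env_in[OF assms(1)] by blast
qed

definition fTriple :: "nat \<Rightarrow> nat \<Rightarrow> nat \<Rightarrow> nat \<Rightarrow> fm"
  where "fTriple p t a b = fEx 2 (And (fPair 2 a b) (fPair p t 2))"

text \<open>The inner pair that the formula asks for is a component of \<open>e p\<close>, hence
  belongs to the transitive set \<open>M\<close> anyway.\<close>

lemma sat_fTriple [simp]:
  assumes "env M e" "2 < p" "2 < t" "2 < a" "2 < b"
  shows "sat M e (fTriple p t a b) \<longleftrightarrow> e p = vpair (e t) (vpair (e a) (e b))"
proof -
  have "sat M e (fTriple p t a b) \<longleftrightarrow> (\<exists>x\<in>elts M. x = vpair (e a) (e b) \<and> e p = vpair (e t) x)"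
    using assms unfolding fTriple_def by (simp cong: ball_cong bex_cong)
  then show ?thesis
    using vpair_components_in_Transset(2) assms(1) unfolding env_def by metis
qed

text \<open>For coded assignments this says that \<open>G\<close> is a variant of \<open>F\<close>
  at the variable \<open>a\<close>. Below, \<open>sing\<close> says that \<open>a\<close> has
  exactly one value, so that it stands for an individual.\<close>

definition sim :: "'v::zfc \<Rightarrow> 'v \<Rightarrow> 'v \<Rightarrow> bool"
  where "sim a F G \<longleftrightarrow> (\<forall>b x. b \<noteq> a \<longrightarrow> (vpair b x \<in> elts F \<longleftrightarrow> vpair b x \<in> elts G))"

definition sing :: "'v::zfc \<Rightarrow> 'v \<Rightarrow> bool"
  where "sing a F \<longleftrightarrow> (\<exists>x. \<forall>y. vpair a y \<in> elts F \<longleftrightarrow> y = x)"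

definition fSim :: "nat \<Rightarrow> nat \<Rightarrow> nat \<Rightarrow> fm"
  where "fSim a F G = All 3 (All 4 (fImp (Neg (Eq 3 a)) (fIff (fIn 3 4 F) (fIn 3 4 G))))"

lemma env_vpair_in:
  assumes "env M e" "vpair a b \<in> elts F" "F \<in> elts M" shows "a \<in> elts M" "b \<in> elts M"
  using assms env_trans vpair_components_in_Transset unfolding env_def by metis+

text \<open>Components of a pair in \<open>e F\<close> or \<open>e G\<close> lie in
  \<open>M\<close>; for any other \<open>b\<close> and \<open>x\<close> both memberships fail, so
  restricting the quantifiers to \<open>M\<close> changes nothing.\<close>

lemma sat_fSim [simp]:
  assumes "env M e" "4 < a" "4 < F" "4 < G"
  shows "sat M e (fSim a F G) \<longleftrightarrow> sim (e a) (e F) (e G)"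
proof -
  have "sat M e (fSim a F G) \<longleftrightarrow> (\<forall>b\<in>elts M. \<forall>x\<in>elts M. b \<noteq> e a \<longrightarrow>
      (vpair b x \<in> elts (e F) \<longleftrightarrow> vpair b x \<in> elts (e G)))"
    using assms unfolding fSim_def by (simp cong: ball_cong bex_cong)
  then show ?thesis
    using env_vpair_in[OF assms(1)] env_in[OF assms(1)] unfolding sim_def by metis
qed

definition fSing :: "nat \<Rightarrow> nat \<Rightarrow> fm"
  where "fSing a F = fEx 3 (All 4 (fIff (fIn a 4 F) (Eq 4 3)))"

lemma sat_fSing [simp]:
  assumes "env M e" "4 < a" "4 < F"
  shows "sat M e (fSing a F) \<longleftrightarrow> sing (e a) (e F)"
proof -
  have "sat M e (fSing a F) \<longleftrightarrow> (\<exists>x\<in>elts M. \<forall>y\<in>elts M. vpair (e a) y \<in> elts (e F) \<longleftrightarrow> y = x)"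
    using assms unfolding fSing_def by (simp cong: ball_cong bex_cong)
  then show ?thesis
    using env_vpair_in[OF assms(1)] env_in[OF assms(1)] unfolding sing_def by metis
qed

text \<open>\<open>X\<close> bounds the search for a witness, which keeps the quantifier over
  subsets of one set. The relation sought may give an element several values in \<open>B\<close>, as
  long as no two elements share one.\<close>

definition fLepoll :: "nat \<Rightarrow> nat \<Rightarrow> nat \<Rightarrow> fm"
  where "fLepoll X A B = fEx 3 (And (fSub 3 X) (And
     (All 4 (fImp (Mem 4 A) (fEx 5 (And (Mem 5 B) (fIn 4 5 3)))))
     (All 4 (fImp (Mem 4 A) (All 5 (fImp (Mem 5 A) (All 6 (fImp (Mem 6 B)
        (fImp (fIn 4 6 3) (fImp (fIn 5 6 3) (Eq 4 5)))))))))))"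

text \<open>\<open>M\<close> has the true collection of subsets of \<open>X\<close>; this is what
  makes second-order statements about \<open>X\<close> absolute for \<open>M\<close>.\<close>

definition pow_closed :: "'v::zfc \<Rightarrow> 'v \<Rightarrow> bool"
  where "pow_closed M X \<longleftrightarrow> (\<forall>F. elts F \<subseteq> elts X \<longrightarrow> F \<in> elts M)"

text \<open>By \<open>pow_closed\<close>, every relation inside \<open>e X\<close> is available in
  \<open>M\<close>. Choosing values in such a relation gives an injection; conversely, the graph of
  an injection is a subset of \<open>e X\<close> by closure under pairs.\<close>

lemma sat_fLepoll [simp]:
  assumes "env M e" "6 < X" "6 < A" "6 < B" and pow: "pow_closed M (e X)"
    and pair: "\<And>a b. a \<in> elts (e X) \<Longrightarrow> b \<in> elts (e X) \<Longrightarrow> vpair a b \<in> elts (e X)"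
    and AB: "elts (e A) \<subseteq> elts (e X)" "elts (e B) \<subseteq> elts (e X)"
  shows "sat M e (fLepoll X A B) \<longleftrightarrow> elts (e A) \<lesssim> elts (e B)" (is "?L \<longleftrightarrow> ?R")
proof -
  have "?L \<longleftrightarrow> (\<exists>h\<in>elts M. elts h \<subseteq> elts (e X) \<and>
     (\<forall>a\<in>elts M. a \<in> elts (e A) \<longrightarrow> (\<exists>b\<in>elts M. b \<in> elts (e B) \<and> vpair a b \<in> elts h)) \<and>
     (\<forall>a\<in>elts M. a \<in> elts (e A) \<longrightarrow> (\<forall>a'\<in>elts M. a' \<in> elts (e A) \<longrightarrow> (\<forall>b\<in>elts M. b \<in> elts (e B) \<longrightarrow>
       vpair a b \<in> elts h \<longrightarrow> vpair a' b \<in> elts h \<longrightarrow> a = a'))))"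
    using assms(1-4) unfolding fLepoll_def by (simp cong: ball_cong bex_cong)
  also have "\<dots> \<longleftrightarrow> (\<exists>h. elts h \<subseteq> elts (e X) \<and>
     (\<forall>a\<in>elts (e A). \<exists>b\<in>elts (e B). vpair a b \<in> elts h) \<and>
     (\<forall>a\<in>elts (e A). \<forall>a'\<in>elts (e A). \<forall>b\<in>elts (e B).
       vpair a b \<in> elts h \<longrightarrow> vpair a' b \<in> elts h \<longrightarrow> a = a'))" (is "_ \<longleftrightarrow> (\<exists>h. ?P h)")
  proof -
    have "(\<exists>h\<in>elts M. elts h \<subseteq> elts (e X) \<and> Q h) \<longleftrightarrow> (\<exists>h. elts h \<subseteq> elts (e X) \<and> Q h)" for Q
      using pow unfolding pow_closed_def by blast
    then show ?thesis by (simp only: env_bounded[OF assms(1)])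
  qed
  also have "\<dots> \<longleftrightarrow> ?R"
  proof
    assume "\<exists>h. ?P h"
    then obtain h where h: "?P h" ..
    then obtain f where f: "\<And>a. a \<in> elts (e A) \<Longrightarrow> f a \<in> elts (e B) \<and> vpair a (f a) \<in> elts h" by metis
    then have "inj_on f (elts (e A))" using h unfolding inj_on_def by metis
    then show ?R using f unfolding lepoll_def by blast
  next
    assume ?R
    then obtain f where f: "inj_on f (elts (e A))" "f ` elts (e A) \<subseteq> elts (e B)"
      unfolding lepoll_def by blast
    define H where "H = (\<lambda>a. vpair a (f a)) ` elts (e A)"
    have H: "elts (set_of H) = H"
      unfolding H_def by (intro elts_set_of small_image small_elts)
    have "H \<subseteq> elts (e X)" unfolding H_def
      by (intro image_subsetI pair) (use f(2) AB in blast)+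
    moreover have "vpair a b \<in> H \<longleftrightarrow> a \<in> elts (e A) \<and> b = f a" for a b
      by (auto simp: H_def)
    ultimately have "?P (set_of H)"
      unfolding H using f by (simp add: inj_on_def image_subset_iff)
    then show "\<exists>h. ?P h" ..
  qed
  finally show ?thesis .
qed

text \<open>From here on the free variables have fixed meanings: 20 is \<open>\<delta>\<close>, 21 is \<open>V\<^sub>\<delta>\<close>, 22 the satisfaction
  class, 23 the set of all codes of formulas (also used as a countably infinite set), 24 the theory,
  25 an assignment, and \<open>30 + k\<close> the natural number \<open>k\<close>.\<close>

definition fOrd :: fm
  where "fOrd = All 10 (fImp (Mem 10 20) (And (fSub 10 20) (All 11 (fImp (Mem 11 10) (fSub 11 10)))))"

lemma sat_fOrd:
  assumes "env M e" shows "sat M e fOrd \<longleftrightarrow> Ord (e 20)"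
proof -
  have "sat M e fOrd \<longleftrightarrow> (\<forall>x\<in>elts M. x \<in> elts (e 20) \<longrightarrow> elts x \<subseteq> elts (e 20) \<and>
      (\<forall>y\<in>elts M. y \<in> elts x \<longrightarrow> elts y \<subseteq> elts x))"
    using assms unfolding fOrd_def by (simp cong: ball_cong bex_cong)
  then show ?thesis
    using env_trans[OF assms] env_in[OF assms, of 20] unfolding Ord_def Transset_def by metis
qed

definition fDirected :: fm
  where "fDirected = All 10 (fImp (Mem 10 20) (All 11 (fImp (Mem 11 20)
    (fEx 12 (And (Mem 12 20) (And (Mem 10 12) (Mem 11 12)))))))"

lemma sat_fDirected:
  assumes "env M e" shows "sat M e fDirected \<longleftrightarrow> directed (e 20)"
  unfolding fDirected_def directed_def by (simp add: env_bounded[OF assms])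

text \<open>Variable 13 is the graph of the family of all \<open>V\<^sub>\<alpha>\<close> with
  \<alpha> in \<delta>, so the transfinite recursion becomes a condition on one subset of
  \<open>V\<^sub>\<delta>\<close>. The last conjunct is the same recursion step taken at \<delta>
  itself.\<close>

definition fHier :: fm
  where "fHier = And (All 10 (fImp (Mem 10 21) (fSub 10 21))) (fEx 13 (And (fSub 13 21) (And
  (All 10 (fImp (Mem 10 20) (All 11 (fIff (fIn 10 11 13)
     (fEx 12 (And (Mem 12 10) (All 14 (fImp (Mem 14 11) (fIn 12 14 13)))))))))
  (All 11 (fIff (Mem 11 21) (fEx 12 (And (Mem 12 20) (All 14 (fImp (Mem 14 11) (fIn 12 14 13))))))))))"

text \<open>The witness is the graph \<open>{(\<alpha>, y). \<alpha> \<in> \<delta>, y \<in> V\<^sub>\<alpha>}\<close>, a subset of \<open>V\<^sub>\<delta>\<close>.\<close>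

lemma sat_fHier:
  assumes e: "env M e" and pow: "pow_closed M (e 21)" and ord: "Ord (e 20)" and dir: "directed (e 20)"
  shows "sat M e fHier \<longleftrightarrow> e 21 = Vset (e 20)"
proof -
  let ?d = "e 20" and ?X = "e 21"
  have tr: "x \<in> elts M" if "x \<in> elts y" "y \<in> elts M" for x y using env_trans[OF e] that .
  have dM: "?d \<in> elts M" and XM: "?X \<in> elts M" using env_in[OF e] by auto
  have sub: "F \<in> elts M" if "elts F \<subseteq> elts ?X" for F using pow that by (simp add: pow_closed_def)
  have dd: "\<beta> \<in> elts ?d" if "\<alpha> \<in> elts ?d" "\<beta> \<in> elts \<alpha>" for \<alpha> \<beta>
    using ord that unfolding Ord_def Transset_def by blast
  have "sat M e fHier \<longleftrightarrow> (\<forall>x\<in>elts M. x \<in> elts ?X \<longrightarrow> elts x \<subseteq> elts ?X) \<and>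
     (\<exists>h\<in>elts M. elts h \<subseteq> elts ?X \<and>
       (\<forall>\<alpha>\<in>elts M. \<alpha> \<in> elts ?d \<longrightarrow> (\<forall>y\<in>elts M. vpair \<alpha> y \<in> elts h \<longleftrightarrow>
          (\<exists>\<beta>\<in>elts M. \<beta> \<in> elts \<alpha> \<and> (\<forall>z\<in>elts M. z \<in> elts y \<longrightarrow> vpair \<beta> z \<in> elts h)))) \<and>
       (\<forall>y\<in>elts M. y \<in> elts ?X \<longleftrightarrow>
          (\<exists>\<beta>\<in>elts M. \<beta> \<in> elts ?d \<and> (\<forall>z\<in>elts M. z \<in> elts y \<longrightarrow> vpair \<beta> z \<in> elts h))))"
    using e unfolding fHier_def by (simp cong: ball_cong bex_cong)
  also have "\<dots> \<longleftrightarrow> Transset ?X \<and>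
     (\<exists>h. elts h \<subseteq> elts ?X \<and>
       (\<forall>\<alpha>\<in>elts ?d. \<forall>y\<in>elts M. vpair \<alpha> y \<in> elts h \<longleftrightarrow>
          (\<exists>\<beta>\<in>elts \<alpha>. \<forall>z\<in>elts y. vpair \<beta> z \<in> elts h)) \<and>
       (\<forall>y\<in>elts M. y \<in> elts ?X \<longleftrightarrow> (\<exists>\<beta>\<in>elts ?d. \<forall>z\<in>elts y. vpair \<beta> z \<in> elts h)))"
    (is "_ \<longleftrightarrow> _ \<and> (\<exists>h. ?P h)")
  proof -
    have all: "(\<forall>a\<in>elts M. a \<in> elts y \<longrightarrow> Q a) \<longleftrightarrow> (\<forall>a\<in>elts y. Q a)"
      and ex: "(\<exists>a\<in>elts M. a \<in> elts y \<and> Q a) \<longleftrightarrow> (\<exists>a\<in>elts y. Q a)" if "y \<in> elts M" for y Q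
      using tr that by blast+
    have exX: "(\<exists>h\<in>elts M. elts h \<subseteq> elts ?X \<and> Q h) \<longleftrightarrow> (\<exists>h. elts h \<subseteq> elts ?X \<and> Q h)" for Q
      using sub by blast
    have dM': "\<alpha> \<in> elts M" if "\<alpha> \<in> elts ?d" for \<alpha> using tr dM that by blast
    show ?thesis unfolding exX Transset_def
      by (simp add: all ex dM XM dM' cong: ball_cong bex_cong)
  qed
  also have "\<dots> \<longleftrightarrow> ?X = Vset ?d"
  proof
    assume "Transset ?X \<and> (\<exists>h. ?P h)"
    then obtain h where X: "Transset ?X" and P: "?P h" by blast
    have h: "elts h \<subseteq> elts ?X" using P by (rule conjunct1)
    have h1: "\<And>\<alpha> y. \<alpha> \<in> elts ?d \<Longrightarrow> y \<in> elts M \<Longrightarrow>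
         vpair \<alpha> y \<in> elts h \<longleftrightarrow> (\<exists>\<beta>\<in>elts \<alpha>. \<forall>z\<in>elts y. vpair \<beta> z \<in> elts h)"
      and h2: "\<And>y. y \<in> elts M \<Longrightarrow> y \<in> elts ?X \<longleftrightarrow> (\<exists>\<beta>\<in>elts ?d. \<forall>z\<in>elts y. vpair \<beta> z \<in> elts h)"
      using P by simp_all
    have hX: "y \<in> elts ?X" if "vpair \<alpha> y \<in> elts h" for \<alpha> y
      using vpair_components_in_Transset(2)[OF X] h that by blast
    have lev: "\<alpha> \<in> elts ?d \<Longrightarrow> (\<forall>y. vpair \<alpha> y \<in> elts h \<longleftrightarrow> y \<in> elts (Vset \<alpha>))" for \<alpha>
    proof (induction \<alpha> rule: elts_induct)
      case (step \<alpha>)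
      have IH: "vpair \<beta> y \<in> elts h \<longleftrightarrow> y \<in> elts (Vset \<beta>)" if "\<beta> \<in> elts \<alpha>" for \<beta> y
        using step dd that by blast
      show ?case
      proof
        fix y
        have iff: "(\<exists>\<beta>\<in>elts \<alpha>. \<forall>z\<in>elts y. vpair \<beta> z \<in> elts h) \<longleftrightarrow> y \<in> elts (Vset \<alpha>)"
          unfolding Vset_iff[of y \<alpha>] subset_iff using IH by (simp add: Ball_def)
        \<comment> \<open>The recursion clause speaks only of \<open>y\<close> in \<open>M\<close>,
          but either side of it forces this: the left makes \<open>y\<close> an element of
          \<open>?X\<close>, the right makes it a subset of \<open>?X\<close>.\<close>
        have "y \<in> elts M" if "vpair \<alpha> y \<in> elts h" using hX[OF that] XM tr by blast
        moreover have "y \<in> elts M" if "\<exists>\<beta>\<in>elts \<alpha>. \<forall>z\<in>elts y. vpair \<beta> z \<in> elts h"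
          using that hX by (intro sub) blast
        ultimately show "vpair \<alpha> y \<in> elts h \<longleftrightarrow> y \<in> elts (Vset \<alpha>)"
          using h1[OF step.prems] iff by metis
      qed
    qed
    have iff: "(\<exists>\<beta>\<in>elts ?d. \<forall>z\<in>elts y. vpair \<beta> z \<in> elts h) \<longleftrightarrow> y \<in> elts (Vset ?d)" for y
      unfolding Vset_iff[of y ?d] subset_iff using lev by (simp add: Ball_def)
    have "y \<in> elts ?X \<longleftrightarrow> y \<in> elts (Vset ?d)" for y
    proof -
      have "y \<in> elts M" if "y \<in> elts ?X" using that XM tr by blast
      moreover have "y \<in> elts M" if "\<exists>\<beta>\<in>elts ?d. \<forall>z\<in>elts y. vpair \<beta> z \<in> elts h"
        using that hX by (intro sub) blast
      ultimately show ?thesis using h2 iff by metis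
    qed
    then show "?X = Vset ?d" by (intro extensionality) blast
  next
    assume X: "?X = Vset ?d"
    define H where "H = {z \<in> elts ?X. \<exists>\<alpha>\<in>elts ?d. \<exists>y\<in>elts (Vset \<alpha>). z = vpair \<alpha> y}"
    have "small H" unfolding H_def by (rule small_subset[OF small_elts[of ?X]]) auto
    then have H: "elts (set_of H) = H" by (rule elts_set_of)
    have HX: "H \<subseteq> elts ?X" by (auto simp: H_def)
    \<comment> \<open>Cutting \<open>H\<close> out of \<open>?X\<close> loses no pair, since
      \<delta> is directed and hence \<open>V\<^sub>\<delta>\<close> is closed under
      pairing.\<close>
    have mem: "vpair \<alpha> y \<in> H \<longleftrightarrow> \<alpha> \<in> elts ?d \<and> y \<in> elts (Vset \<alpha>)" for \<alpha> y
    proof -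
      have "vpair \<alpha> y \<in> elts ?X" if "\<alpha> \<in> elts ?d" "y \<in> elts (Vset \<alpha>)"
        unfolding X using that elts_subset_Vset Vset_subset by (intro Vset_directed_vpair[OF dir]) blast+
      then show ?thesis by (auto simp: H_def)
    qed
    have "(\<exists>\<beta>\<in>elts \<alpha>. \<forall>z\<in>elts y. vpair \<beta> z \<in> H) \<longleftrightarrow> y \<in> elts (Vset \<alpha>)"
      if "elts \<alpha> \<subseteq> elts ?d" for \<alpha> y
      unfolding Vset_iff[of y \<alpha>] mem using that by blast
    then have "?P (set_of H)"
      using HX dd unfolding H by (simp add: mem X subset_iff)
    then have "\<exists>h. ?P h" by (rule exI)
    moreover have "Transset ?X" unfolding X by (rule Transset_Vset)
    ultimately show "Transset ?X \<and> (\<exists>h. ?P h)" by (intro conjI)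
  qed
  finally show ?thesis .
qed

text \<open>The first four conjuncts ensure that the others are read correctly: they make 21 the
  level \<open>V\<^sub>\<delta>\<close>, closed under pairs, with the countable set 23 inside it.
  The rest follows \<open>inaccessible_iff\<close>; in the last conjunct 11 is the power set of
  10.\<close>

definition fInacc :: fm
  where "fInacc = And fOrd (And fDirected (And fHier (And (fSub 23 21) (And (Neg (fLepoll 21 20 23)) (And
    (All 10 (fImp (Mem 10 20) (Neg (fLepoll 21 20 10)))) (And
    (All 10 (fImp (fSub 10 20) (fImp (Neg (fLepoll 21 20 10)) (fEx 11 (And (Mem 11 20) (fSub 10 11))))))
    (All 10 (fImp (Mem 10 20) (fEx 11 (And (fSub 11 21) (And (All 12 (fIff (Mem 12 11) (fSub 12 10)))
      (And (fLepoll 21 11 20) (Neg (fLepoll 21 20 11))))))))))))))"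

lemma sat_fInacc:
  assumes e: "env M e" and pow: "pow_closed M (e 21)" and N: "countable (elts (e 23))" "infinite (elts (e 23))"
    and NV: "\<And>\<delta>. inaccessible \<delta> \<Longrightarrow> elts (e 23) \<subseteq> elts (Vset \<delta>)"
  shows "sat M e fInacc \<longleftrightarrow> inaccessible (e 20) \<and> e 21 = Vset (e 20)"
\<comment> \<open>If a background condition fails, both sides are false: \<open>fInacc\<close>
  asserts these conditions, and the right-hand side implies them. Otherwise the remaining conjuncts
  can be evaluated one by one.\<close>
proof (cases "Ord (e 20) \<and> directed (e 20) \<and> e 21 = Vset (e 20) \<and> elts (e 23) \<subseteq> elts (e 21)")
  case False
  then show ?thesis
    using sat_fOrd[OF e] sat_fDirected[OF e] sat_fHier[OF e pow] NV[of "e 20"] e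
      inaccessible_directed[of "e 20"]
    unfolding fInacc_def inaccessible_def regular_def Card_def by auto
next
  case True
  let ?d = "e 20" and ?X = "e 21"
  have tr: "x \<in> elts M" if "x \<in> elts y" "y \<in> elts M" for x y using env_trans[OF e] that .
  have XM: "?X \<in> elts M" using env_in[OF e] by auto
  have sub: "F \<in> elts M" if "elts F \<subseteq> elts ?X" for F using pow that by (simp add: pow_closed_def)
  have NX: "elts (e 23) \<subseteq> elts ?X" using True by blast
  have dX: "elts ?d \<subseteq> elts ?X" using True elts_subset_Vset by metis
  have ordX: "elts \<alpha> \<subseteq> elts ?d" if "\<alpha> \<in> elts ?d" for \<alpha>
    using that True unfolding Ord_def Transset_def by blast
  have pair: "vpair a b \<in> elts ?X" if "a \<in> elts ?X" "b \<in> elts ?X" for a b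
    using that True Vset_directed_vpair by metis
  have l1: "sat M (e(10 := \<alpha>)) (fLepoll 21 20 10) \<longleftrightarrow> elts ?d \<lesssim> elts \<alpha>"
    if "elts \<alpha> \<subseteq> elts ?d" for \<alpha>
  proof -
    have "elts \<alpha> \<subseteq> elts ?X" using that dX by blast
    then show ?thesis using e pow pair sub dX by (subst sat_fLepoll) simp_all
  qed
  have l2: "sat M (e(10 := \<alpha>, 11 := w)) (fLepoll 21 11 20) \<longleftrightarrow> elts w \<lesssim> elts ?d"
      "sat M (e(10 := \<alpha>, 11 := w)) (fLepoll 21 20 11) \<longleftrightarrow> elts ?d \<lesssim> elts w"
    if "\<alpha> \<in> elts M" "elts w \<subseteq> elts ?X" for \<alpha> w
    using e pow pair that dX sub by (subst sat_fLepoll; simp)+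
  have c0: "sat M e (fLepoll 21 20 23) \<longleftrightarrow> elts ?d \<lesssim> elts (e 23)"
    using e pow pair dX NX by (subst sat_fLepoll) simp_all
  have c1: "sat M e (All 10 (fImp (Mem 10 20) (Neg (fLepoll 21 20 10)))) \<longleftrightarrow>
      (\<forall>\<alpha>\<in>elts ?d. \<not> elts ?d \<lesssim> elts \<alpha>)"
    by (simp add: l1 ordX env_bounded[OF e] cong: ball_cong)
  have c2: "sat M e (All 10 (fImp (fSub 10 20) (fImp (Neg (fLepoll 21 20 10)) (fEx 11 (And (Mem 11 20) (fSub 10 11)))))) \<longleftrightarrow>
      (\<forall>Y. elts Y \<subseteq> elts ?d \<and> \<not> elts ?d \<lesssim> elts Y \<longrightarrow> (\<exists>\<beta>\<in>elts ?d. elts Y \<subseteq> elts \<beta>))"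
  proof -
    have "sat M e (All 10 (fImp (fSub 10 20) (fImp (Neg (fLepoll 21 20 10)) (fEx 11 (And (Mem 11 20) (fSub 10 11)))))) \<longleftrightarrow>
      (\<forall>Y\<in>elts M. elts Y \<subseteq> elts ?d \<longrightarrow> \<not> elts ?d \<lesssim> elts Y \<longrightarrow> (\<exists>\<beta>\<in>elts ?d. elts Y \<subseteq> elts \<beta>))"
      using e by (simp add: l1 env_bounded[OF e] cong: ball_cong bex_cong)
    \<comment> \<open>Subsets of \<delta> are subsets of \<open>V\<^sub>\<delta>\<close>, so
      \<open>M\<close> contains them all.\<close>
    also have "(\<forall>Y\<in>elts M. elts Y \<subseteq> elts ?d \<longrightarrow> Q Y) \<longleftrightarrow> (\<forall>Y. elts Y \<subseteq> elts ?d \<longrightarrow> Q Y)" for Q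
      using sub dX by blast
    finally show ?thesis by (simp only: imp_conjL)
  qed
  have c3: "sat M e (All 10 (fImp (Mem 10 20) (fEx 11 (And (fSub 11 21) (And (All 12 (fIff (Mem 12 11) (fSub 12 10)))
      (And (fLepoll 21 11 20) (Neg (fLepoll 21 20 11)))))))) \<longleftrightarrow>
      (\<forall>\<alpha>\<in>elts ?d. elts (vpow \<alpha>) \<lesssim> elts ?d \<and> \<not> elts ?d \<lesssim> elts (vpow \<alpha>))" (is "sat M e ?p \<longleftrightarrow> _")
  proof -
    have "sat M e ?p \<longleftrightarrow> (\<forall>\<alpha>\<in>elts M. \<alpha> \<in> elts ?d \<longrightarrow> (\<exists>w\<in>elts M. elts w \<subseteq> elts ?X \<and>
        (\<forall>y\<in>elts M. y \<in> elts w \<longleftrightarrow> elts y \<subseteq> elts \<alpha>) \<and> elts w \<lesssim> elts ?d \<and> \<not> elts ?d \<lesssim> elts w))"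
      using e by (simp add: l2 cong: ball_cong bex_cong conj_cong)
    also have "\<dots> \<longleftrightarrow> (\<forall>\<alpha>\<in>elts ?d. \<exists>w. w = vpow \<alpha> \<and> elts w \<lesssim> elts ?d \<and> \<not> elts ?d \<lesssim> elts w)"
    proof -
      \<comment> \<open>\<open>M\<close> computes the power set of \<alpha> correctly: it contains
        every subset of \<alpha>, and the true power set is an element of \<open>?X\<close> because
        \<delta> is directed.\<close>
      have eq: "(w \<in> elts M \<and> elts w \<subseteq> elts ?X \<and> (\<forall>y\<in>elts M. y \<in> elts w \<longleftrightarrow> elts y \<subseteq> elts \<alpha>)) \<longleftrightarrow> w = vpow \<alpha>"
        if a: "\<alpha> \<in> elts ?d" for w \<alpha>
      proof
        assume w: "w \<in> elts M \<and> elts w \<subseteq> elts ?X \<and> (\<forall>y\<in>elts M. y \<in> elts w \<longleftrightarrow> elts y \<subseteq> elts \<alpha>)"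
        have "y \<in> elts w \<longleftrightarrow> elts y \<subseteq> elts \<alpha>" for y
          using w tr sub ordX[OF a] dX by (meson subset_trans)
        then show "w = vpow \<alpha>" by (intro extensionality) auto
      next
        assume w: "w = vpow \<alpha>"
        have "vpow \<alpha> \<in> elts ?X" using a dX True Vset_directed_vpow by (metis subsetD)
        moreover have "elts (vpow \<alpha>) \<subseteq> elts ?X"
          using calculation True Transset_Vset[of ?d] unfolding Transset_def by metis
        ultimately show "w \<in> elts M \<and> elts w \<subseteq> elts ?X \<and> (\<forall>y\<in>elts M. y \<in> elts w \<longleftrightarrow> elts y \<subseteq> elts \<alpha>)"
          using w tr XM by simp
      qed
      show ?thesis unfolding env_bounded[OF e]
        by (intro ball_cong refl) (simp only: eq[symmetric] Bex_def conj_assoc)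
    qed
    finally show ?thesis by simp
  qed
  have "sat M e fOrd" "sat M e fDirected" "sat M e fHier"
    using True sat_fOrd[OF e] sat_fDirected[OF e] sat_fHier[OF e pow] by blast+
  moreover have "sat M e (fSub 23 21)" using NX e by simp
  ultimately have "sat M e fInacc \<longleftrightarrow> inaccessible ?d"
    unfolding fInacc_def inaccessible_iff[OF N] sat.simps(3,4) c0 c1 c2 c3 using True by blast
  then show ?thesis using True by simp
qed

section \<open>Satisfaction classes for second-order logic\<close>

instance fm2 :: countable
  by countable_datatype

definition ivar :: "nat \<Rightarrow> 'v::zfc" where "ivar n = vpair (vnat 0) (vnat n)"
definition cvar :: "nat \<Rightarrow> 'v::zfc" where "cvar n = vpair (vnat 1) (vnat n)"

lemma var_simps [simp]:
  "ivar m = (ivar n :: 'v::zfc) \<longleftrightarrow> m = n" "cvar m = (cvar n :: 'v::zfc) \<longleftrightarrow> m = n"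
  "ivar m \<noteq> (cvar n :: 'v::zfc)" "cvar m \<noteq> (ivar n :: 'v::zfc)"
  by (auto simp: ivar_def cvar_def)

text \<open>All codes are made tagged pairs so that one clause scheme serves every connective;
  negation simply repeats its subformula.\<close>

definition triple :: "nat \<Rightarrow> 'v::zfc \<Rightarrow> 'v \<Rightarrow> 'v"
  where "triple k a b = vpair (vnat k) (vpair a b)"

lemma triple_inject [simp]: "triple k a b = triple l c d \<longleftrightarrow> k = l \<and> a = c \<and> b = (d :: 'v::zfc)"
  by (simp add: triple_def)

text \<open>\<open>Eq2\<close> and \<open>MemC2\<close> may share a tag: on assignments coded as in \<open>codes\<close> below, both say that
  the values of the two variables intersect.\<close>

primrec code :: "fm2 \<Rightarrow> 'v::zfc" where
  "code (Mem2 i j) = triple 0 (ivar i) (ivar j)"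
| "code (Eq2 i j) = triple 1 (ivar i) (ivar j)"
| "code (MemC2 i j) = triple 1 (ivar i) (cvar j)"
| "code (Neg2 p) = triple 2 (code p) (code p)"
| "code (And2 p q) = triple 3 (code p) (code q)"
| "code (All2 i p) = triple 4 (ivar i) (code p)"
| "code (AllC2 i p) = triple 5 (cvar i) (code p)"

lemma code_inject [simp]: "code p = (code q :: 'v::zfc) \<longleftrightarrow> p = q"
proof
  show "code p = (code q :: 'v) \<Longrightarrow> p = q"
    by (induction p arbitrary: q; case_tac q; simp)
qed simp

lemma triple_in_Vset:
  "inaccessible \<delta> \<Longrightarrow> a \<in> elts (Vset \<delta>) \<Longrightarrow> b \<in> elts (Vset \<delta>) \<Longrightarrow> triple k a b \<in> elts (Vset \<delta>)"
  unfolding triple_def by (intro Vset_directed_vpair inaccessible_directed vnat_in_Vset)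

lemma var_in_Vset:
  assumes "inaccessible \<delta>" shows "ivar n \<in> elts (Vset \<delta>)" "cvar n \<in> elts (Vset \<delta>)"
  unfolding ivar_def cvar_def
  using assms by (intro Vset_directed_vpair inaccessible_directed vnat_in_Vset; assumption)+

lemma code_in_Vset: "inaccessible \<delta> \<Longrightarrow> code p \<in> elts (Vset \<delta>)"
  by (induction p) (auto intro: triple_in_Vset var_in_Vset)

section \<open>Truth under coded assignments\<close>

definition codes :: "'v::zfc \<Rightarrow> (nat \<Rightarrow> 'v) \<Rightarrow> (nat \<Rightarrow> 'v set) \<Rightarrow> bool"
  where "codes F e E \<longleftrightarrow> (\<forall>n x. vpair (ivar n) x \<in> elts F \<longleftrightarrow> x = e n) \<and>
    (\<forall>n x. vpair (cvar n) x \<in> elts F \<longleftrightarrow> x \<in> E n)"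

text \<open>Both kinds of quantifier become quantification over subsets \<open>G\<close> of
  \<open>X\<close>, with \<open>sing\<close> keeping individual variables single-valued. The
  existential form of the atomic clauses makes sense for every \<open>F\<close>, whether or not it
  codes an assignment.\<close>

primrec satF :: "'v::zfc \<Rightarrow> 'v \<Rightarrow> fm2 \<Rightarrow> bool" where
  "satF X F (Mem2 i j) \<longleftrightarrow> (\<exists>x y. vpair (ivar i) x \<in> elts F \<and> vpair (ivar j) y \<in> elts F \<and> x \<in> elts y)"
| "satF X F (Eq2 i j) \<longleftrightarrow> (\<exists>x. vpair (ivar i) x \<in> elts F \<and> vpair (ivar j) x \<in> elts F)"
| "satF X F (MemC2 i j) \<longleftrightarrow> (\<exists>x. vpair (ivar i) x \<in> elts F \<and> vpair (cvar j) x \<in> elts F)"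
| "satF X F (Neg2 p) \<longleftrightarrow> \<not> satF X F p"
| "satF X F (And2 p q) \<longleftrightarrow> satF X F p \<and> satF X F q"
| "satF X F (All2 i p) \<longleftrightarrow> (\<forall>G. elts G \<subseteq> elts X \<longrightarrow> sim (ivar i) F G \<longrightarrow> sing (ivar i) G \<longrightarrow> satF X G p)"
| "satF X F (AllC2 i p) \<longleftrightarrow> (\<forall>G. elts G \<subseteq> elts X \<longrightarrow> sim (cvar i) F G \<longrightarrow> satF X G p)"

text \<open>Drop the pairs of \<open>F\<close> at \<open>a\<close> and insert those for
  \<open>A\<close>: the coded counterpart of updating an assignment.\<close>

lemma ex_update:
  fixes F X :: "'v::zfc"
  assumes "elts F \<subseteq> elts X" "\<And>x. x \<in> A \<Longrightarrow> vpair a x \<in> elts X"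
  obtains G where "elts G \<subseteq> elts X" "sim a F G" "\<And>x. vpair a x \<in> elts G \<longleftrightarrow> x \<in> A"
proof -
  define H where "H = {z \<in> elts X. (\<exists>x\<in>A. z = vpair a x) \<or> z \<in> elts F \<and> (\<forall>x. z \<noteq> vpair a x)}"
  have "small H" unfolding H_def by (rule small_subset[OF small_elts[of X]]) auto
  then have H: "elts (set_of H) = H" by (rule elts_set_of)
  show ?thesis
    by (rule that[of "set_of H"]) (use assms in \<open>auto simp: H sim_def, auto simp: H_def\<close>)
qed

lemma codes_update_ivar:
  assumes "codes F e E" "sim (ivar i) F G" "\<And>x. vpair (ivar i) x \<in> elts G \<longleftrightarrow> x = a"
  shows "codes G (e(i := a)) E"
  using assms unfolding codes_def sim_def by (auto; metis var_simps)

lemma codes_update_cvar: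
  assumes "codes F e E" "sim (cvar i) F G" "\<And>x. vpair (cvar i) x \<in> elts G \<longleftrightarrow> x \<in> A"
  shows "codes G e (E(i := A))"
  using assms unfolding codes_def sim_def by (auto; metis var_simps)

text \<open>Updates of \<open>e\<close> or \<open>E\<close> correspond to variants \<open>G\<close>
  of \<open>F\<close>. An update is realised by \<open>ex_update\<close>, as
  \<open>V\<^sub>\<delta>\<close> contains the variables and is closed under pairs; conversely the
  new value is read off \<open>G\<close> and lies in \<open>V\<^sub>\<delta>\<close> by
  transitivity.\<close>

lemma satF_iff_sat2:
  assumes \<delta>: "inaccessible \<delta>"
  shows "elts F \<subseteq> elts (Vset \<delta>) \<Longrightarrow> codes F e E \<Longrightarrow> satF (Vset \<delta>) F p \<longleftrightarrow> sat2 (Vset \<delta>) e E p"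
proof (induction p arbitrary: F e E)
  case (All2 i p)
  let ?X = "Vset \<delta>"
  show ?case
  proof
    assume L: "satF ?X F (All2 i p)"
    show "sat2 ?X e E (All2 i p)" unfolding sat2.simps
    proof
      fix a assume a: "a \<in> elts ?X"
      then have "vpair (ivar i) x \<in> elts ?X" if "x \<in> {a}" for x
        using that \<delta> by (auto intro: Vset_directed_vpair inaccessible_directed var_in_Vset)
      then obtain G where G: "elts G \<subseteq> elts ?X" "sim (ivar i) F G" "\<And>x. vpair (ivar i) x \<in> elts G \<longleftrightarrow> x \<in> {a}"
        using ex_update[OF All2.prems(1)] by metis
      then have "codes G (e(i := a)) E" using codes_update_ivar[OF All2.prems(2)] by simp
      moreover have "sing (ivar i) G" using G(3) unfolding sing_def by auto
      moreover have "satF ?X G p" using L G(1,2) calculation(2) by simp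
      ultimately show "sat2 ?X (e(i := a)) E p" using All2.IH[OF G(1)] by blast
    qed
  next
    assume R: "sat2 ?X e E (All2 i p)"
    show "satF ?X F (All2 i p)" unfolding satF.simps
    proof (intro allI impI)
      fix G assume G: "elts G \<subseteq> elts ?X" "sim (ivar i) F G" "sing (ivar i) G"
      then obtain a where a: "\<And>x. vpair (ivar i) x \<in> elts G \<longleftrightarrow> x = a" unfolding sing_def by blast
      then have "vpair (ivar i) a \<in> elts ?X" using G(1) by blast
      then have "a \<in> elts ?X" using vpair_components_in_Transset(2)[OF Transset_Vset] by blast
      then show "satF ?X G p"
        using R All2.IH[OF G(1) codes_update_ivar[OF All2.prems(2) G(2) a]] unfolding sat2.simps by blast
    qed
  qed
next
  case (AllC2 i p)
  let ?X = "Vset \<delta>"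
  show ?case
  proof
    assume L: "satF ?X F (AllC2 i p)"
    show "sat2 ?X e E (AllC2 i p)" unfolding sat2.simps
    proof (intro allI impI)
      fix A assume A: "A \<subseteq> elts ?X"
      then have "vpair (cvar i) x \<in> elts ?X" if "x \<in> A" for x
        using that \<delta> by (auto intro: Vset_directed_vpair inaccessible_directed var_in_Vset)
      then obtain G where G: "elts G \<subseteq> elts ?X" "sim (cvar i) F G" "\<And>x. vpair (cvar i) x \<in> elts G \<longleftrightarrow> x \<in> A"
        using ex_update[OF AllC2.prems(1)] by metis
      then have "codes G e (E(i := A))" using codes_update_cvar[OF AllC2.prems(2)] by simp
      moreover have "satF ?X G p" using L G(1,2) by simp
      ultimately show "sat2 ?X e (E(i := A)) p" using AllC2.IH[OF G(1)] by blast
    qed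
  next
    assume R: "sat2 ?X e E (AllC2 i p)"
    show "satF ?X F (AllC2 i p)" unfolding satF.simps
    proof (intro allI impI)
      fix G assume G: "elts G \<subseteq> elts ?X" "sim (cvar i) F G"
      define A where "A = {x. vpair (cvar i) x \<in> elts G}"
      have "A \<subseteq> elts ?X"
        using vpair_components_in_Transset(2)[OF Transset_Vset] G(1) unfolding A_def by blast
      moreover have "codes G e (E(i := A))"
        using codes_update_cvar[OF AllC2.prems(2) G(2)] by (simp add: A_def)
      ultimately show "satF ?X G p" using R AllC2.IH[OF G(1)] unfolding sat2.simps by blast
    qed
  qed
next
  case (Neg2 p)
  show ?case using Neg2.IH[OF Neg2.prems] by simp
next
  case (And2 p q)
  show ?case using And2.IH(1)[OF And2.prems] And2.IH(2)[OF And2.prems] by simp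
qed (simp_all add: codes_def)

text \<open>The scheme for one of Tarski's clauses: 40 is a code with tag \<open>k\<close> and
  components 41 and 42, 43 is an assignment, and \<open>\<psi>\<close> states when the satisfaction
  class should hold.\<close>

definition fClause :: "nat \<Rightarrow> fm \<Rightarrow> fm"
  where "fClause k \<psi> = All 40 (fImp (Mem 40 23) (All 41 (All 42 (fImp (fTriple 40 (30 + k) 41 42)
    (All 43 (fImp (fSub 43 21) (fIff (fIn 40 43 22) \<psi>)))))))"

text \<open>\<open>R\<close> is the meaning of \<open>\<psi>\<close>. Codes and their components lie
  in \<open>M\<close> by transitivity and assignments by \<open>pow_closed\<close>, so all
  quantifiers become unrestricted. The bound on \<open>k\<close> keeps the tag variables apart from
  those bound from 40 on.\<close>

lemma sat_fClause:
  fixes M :: "'v::zfc"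
  assumes e: "env M e" and pow: "pow_closed M (e 21)" and N: "elts (e 23) = range code"
    and k: "e (30 + k) = vnat k" "k < 10"
    and \<psi>: "\<And>p a b F. p \<in> elts M \<Longrightarrow> a \<in> elts M \<Longrightarrow> b \<in> elts M \<Longrightarrow> F \<in> elts M \<Longrightarrow>
      sat M (e(40 := p, 41 := a, 42 := b, 43 := F)) \<psi> \<longleftrightarrow> R a b F"
  shows "sat M e (fClause k \<psi>) \<longleftrightarrow>
    (\<forall>p a b F. code p = triple k a b \<longrightarrow> elts F \<subseteq> elts (e 21) \<longrightarrow> (vpair (code p) F \<in> elts (e 22) \<longleftrightarrow> R a b F))"
proof -
  have "sat M e (fClause k \<psi>) \<longleftrightarrow> (\<forall>c\<in>elts M. c \<in> elts (e 23) \<longrightarrow> (\<forall>a\<in>elts M. \<forall>b\<in>elts M.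
     c = triple k a b \<longrightarrow> (\<forall>F\<in>elts M. elts F \<subseteq> elts (e 21) \<longrightarrow> (vpair c F \<in> elts (e 22) \<longleftrightarrow> R a b F))))"
  proof -
    have body: "sat M (e(40 := c, 41 := a, 42 := b)) (All 43 (fImp (fSub 43 21) (fIff (fIn 40 43 22) \<psi>))) \<longleftrightarrow>
        (\<forall>F\<in>elts M. elts F \<subseteq> elts (e 21) \<longrightarrow> (vpair c F \<in> elts (e 22) \<longleftrightarrow> R a b F))"
      and trip: "sat M (e(40 := c, 41 := a, 42 := b)) (fTriple 40 (30 + k) 41 42) \<longleftrightarrow> c = triple k a b"
      if "c \<in> elts M" "a \<in> elts M" "b \<in> elts M" for c a b
      using that e k \<psi> by (simp_all add: triple_def cong: ball_cong)
    show ?thesis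
      unfolding fClause_def sat_connectives(3) sat.simps(5)[of _ _ 40] sat.simps(5)[of _ _ 41] sat.simps(5)[of _ _ 42]
      by (intro ball_cong refl arg_cong2[where f = "(\<longrightarrow>)"]) (simp_all only: body trip, simp)
  qed
  also have "\<dots> \<longleftrightarrow> (\<forall>p. \<forall>a\<in>elts M. \<forall>b\<in>elts M.
     code p = triple k a b \<longrightarrow> (\<forall>F\<in>elts M. elts F \<subseteq> elts (e 21) \<longrightarrow> (vpair (code p) F \<in> elts (e 22) \<longleftrightarrow> R a b F)))"
    unfolding env_bounded[OF e] unfolding N by (simp only: ball_simps ball_UNIV)
  also have "\<dots> \<longleftrightarrow> (\<forall>p a b F. code p = triple k a b \<longrightarrow> elts F \<subseteq> elts (e 21) \<longrightarrow> (vpair (code p) F \<in> elts (e 22) \<longleftrightarrow> R a b F))"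
  proof -
    have abM: "a \<in> elts M \<and> b \<in> elts M" if "code p = triple k a b" for p a b
    proof -
      have "code p \<in> elts (e 23)" using N by simp
      then have "triple k a b \<in> elts M" using that env_trans[OF e] env_in[OF e] by metis
      then show ?thesis using e vpair_components_in_Transset unfolding triple_def env_def by metis
    qed
    have "(\<forall>a\<in>elts M. \<forall>b\<in>elts M. code p = triple k a b \<longrightarrow> Q a b) \<longleftrightarrow> (\<forall>a b. code p = triple k a b \<longrightarrow> Q a b)" for p Q
      using abM by blast
    moreover have "(\<forall>F\<in>elts M. elts F \<subseteq> elts (e 21) \<longrightarrow> Q F) \<longleftrightarrow> (\<forall>F. elts F \<subseteq> elts (e 21) \<longrightarrow> Q F)" for Q
      using pow unfolding pow_closed_def by blast
    ultimately show ?thesis by (simp only: all_simps)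
  qed
  finally show ?thesis .
qed

text \<open>The clauses follow the tags in order; tag 1 handles \<open>Eq2\<close> and
  \<open>MemC2\<close> together. From tag 2 on they refer back to the class 22, so the recursion
  appears as a closure condition on it.\<close>

definition fSat :: fm
  where "fSat = And (fClause 0 (fEx 45 (fEx 46 (And (fIn 41 45 43) (And (fIn 42 46 43) (Mem 45 46))))))
    (And (fClause 1 (fEx 45 (And (fIn 41 45 43) (fIn 42 45 43))))
    (And (fClause 2 (Neg (fIn 41 43 22)))
    (And (fClause 3 (And (fIn 41 43 22) (fIn 42 43 22)))
    (And (fClause 4 (All 44 (fImp (fSub 44 21) (fImp (fSim 41 43 44) (fImp (fSing 41 44) (fIn 42 44 22))))))
         (fClause 5 (All 44 (fImp (fSub 44 21) (fImp (fSim 41 43 44) (fIn 42 44 22)))))))))"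

text \<open>By induction on formulas, the clauses leave only one possible truth value for each code
  and assignment. Conversely, genuine truth obeys each clause, by inspecting which formulas carry
  its tag.\<close>

lemma sat_fSat:
  fixes M :: "'v::zfc"
  assumes e: "env M e" and pow: "pow_closed M (e 21)" and N: "elts (e 23) = range code"
    and tags: "\<And>k. k < 6 \<Longrightarrow> e (30 + k) = vnat k"
  shows "sat M e fSat \<longleftrightarrow>
    (\<forall>p F. elts F \<subseteq> elts (e 21) \<longrightarrow> (vpair (code p) F \<in> elts (e 22) \<longleftrightarrow> satF (e 21) F p))" (is "?L \<longleftrightarrow> ?R")
proof -
  let ?X = "e 21" and ?S = "e 22"
  \<comment> \<open>\<open>K k R\<close> is the semantic content of the clause with tag
    \<open>k\<close>, as delivered by \<open>sat_fClause\<close>.\<close>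
  define K where "K k R \<longleftrightarrow> (\<forall>p a b (F::'v). code p = triple k a b \<longrightarrow> elts F \<subseteq> elts ?X \<longrightarrow>
      (vpair (code p) F \<in> elts ?S \<longleftrightarrow> R a b F))"
    for k and R :: "'v \<Rightarrow> 'v \<Rightarrow> 'v \<Rightarrow> bool"
  have sub: "F \<in> elts M" if "elts F \<subseteq> elts ?X" for F using pow that by (simp add: pow_closed_def)
  have exb: "(\<exists>x\<in>elts M. vpair a x \<in> elts F \<and> Q x) \<longleftrightarrow> (\<exists>x. vpair a x \<in> elts F \<and> Q x)" if "F \<in> elts M" for a F Q
    using env_vpair_in(2)[OF e _ that] by blast
  have allb: "(\<forall>G\<in>elts M. elts G \<subseteq> elts ?X \<longrightarrow> Q G) \<longleftrightarrow> (\<forall>G. elts G \<subseteq> elts ?X \<longrightarrow> Q G)" for Q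
    using sub by blast
  have c0: "sat M e (fClause 0 (fEx 45 (fEx 46 (And (fIn 41 45 43) (And (fIn 42 46 43) (Mem 45 46)))))) \<longleftrightarrow>
      K 0 (\<lambda>a b F. \<exists>x. vpair a x \<in> elts F \<and> (\<exists>y. vpair b y \<in> elts F \<and> x \<in> elts y))"
    unfolding K_def using tags[of 0]
    by (intro sat_fClause[OF e pow N]) (simp_all add: e exb cong: bex_cong)
  have c1: "sat M e (fClause 1 (fEx 45 (And (fIn 41 45 43) (fIn 42 45 43)))) \<longleftrightarrow>
      K 1 (\<lambda>a b F. \<exists>x. vpair a x \<in> elts F \<and> vpair b x \<in> elts F)"
    unfolding K_def using tags[of 1]
    by (intro sat_fClause[OF e pow N]) (simp_all add: e exb cong: bex_cong)
  have c2: "sat M e (fClause 2 (Neg (fIn 41 43 22))) \<longleftrightarrow> K 2 (\<lambda>a b F. vpair a F \<notin> elts ?S)"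
    unfolding K_def using tags[of 2] by (intro sat_fClause[OF e pow N]) (simp_all add: e)
  have c3: "sat M e (fClause 3 (And (fIn 41 43 22) (fIn 42 43 22))) \<longleftrightarrow>
      K 3 (\<lambda>a b F. vpair a F \<in> elts ?S \<and> vpair b F \<in> elts ?S)"
    unfolding K_def using tags[of 3] by (intro sat_fClause[OF e pow N]) (simp_all add: e)
  have c4: "sat M e (fClause 4 (All 44 (fImp (fSub 44 21) (fImp (fSim 41 43 44) (fImp (fSing 41 44) (fIn 42 44 22)))))) \<longleftrightarrow>
      K 4 (\<lambda>a b F. \<forall>G. elts G \<subseteq> elts ?X \<longrightarrow> sim a F G \<longrightarrow> sing a G \<longrightarrow> vpair b G \<in> elts ?S)"
    unfolding K_def using tags[of 4]
    by (intro sat_fClause[OF e pow N]) (simp_all add: e allb cong: ball_cong)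
  have c5: "sat M e (fClause 5 (All 44 (fImp (fSub 44 21) (fImp (fSim 41 43 44) (fIn 42 44 22))))) \<longleftrightarrow>
      K 5 (\<lambda>a b F. \<forall>G. elts G \<subseteq> elts ?X \<longrightarrow> sim a F G \<longrightarrow> vpair b G \<in> elts ?S)"
    unfolding K_def using tags[of 5]
    by (intro sat_fClause[OF e pow N]) (simp_all add: e allb cong: ball_cong)
  note c = c0 c1 c2 c3 c4 c5
  show ?thesis
  proof
    assume ?L
    then have L: "K 0 (\<lambda>a b F. \<exists>x. vpair a x \<in> elts F \<and> (\<exists>y. vpair b y \<in> elts F \<and> x \<in> elts y))"
      "K 1 (\<lambda>a b F. \<exists>x. vpair a x \<in> elts F \<and> vpair b x \<in> elts F)"
      "K 2 (\<lambda>a b F. vpair a F \<notin> elts ?S)"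
      "K 3 (\<lambda>a b F. vpair a F \<in> elts ?S \<and> vpair b F \<in> elts ?S)"
      "K 4 (\<lambda>a b F. \<forall>G. elts G \<subseteq> elts ?X \<longrightarrow> sim a F G \<longrightarrow> sing a G \<longrightarrow> vpair b G \<in> elts ?S)"
      "K 5 (\<lambda>a b F. \<forall>G. elts G \<subseteq> elts ?X \<longrightarrow> sim a F G \<longrightarrow> vpair b G \<in> elts ?S)"
      unfolding fSat_def sat.simps(4) c by blast+
    have KD: "vpair (code p) F \<in> elts ?S \<longleftrightarrow> R a b F"
      if "K k R" "code p = triple k a b" "elts F \<subseteq> elts ?X" for k R p a b F
      using that unfolding K_def by blast
    have "elts F \<subseteq> elts ?X \<Longrightarrow> vpair (code p) F \<in> elts ?S \<longleftrightarrow> satF ?X F p" for p F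
    proof (induction p arbitrary: F)
      case (Mem2 i j)
      then show ?case using KD[OF L(1) code.simps(1)] by auto
    next
      case (Eq2 i j)
      then show ?case using KD[OF L(2) code.simps(2)] by simp
    next
      case (MemC2 i j)
      then show ?case using KD[OF L(2) code.simps(3)] by simp
    next
      case (Neg2 p)
      then show ?case using KD[OF L(3) code.simps(4)] by simp
    next
      case (And2 p q)
      then show ?case using KD[OF L(4) code.simps(5)] by simp
    next
      case (All2 i p)
      then show ?case using KD[OF L(5) code.simps(6)] by simp
    next
      case (AllC2 i p)
      then show ?case using KD[OF L(6) code.simps(7)] by simp
    qed
    then show ?R by blast
  next
    assume R: ?R
    have KI: "K k Q" if "\<And>p a b F. code p = triple k a b \<Longrightarrow> elts F \<subseteq> elts ?X \<Longrightarrow> satF ?X F p \<longleftrightarrow> Q a b F" for k Q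
      unfolding K_def using that R by (intro allI impI) metis
    show ?L unfolding fSat_def sat.simps(4) c
    proof (intro conjI; rule KI)
      fix p and a b F :: 'v
      assume F: "elts F \<subseteq> elts ?X"
      show "code p = triple 0 a b \<Longrightarrow> satF ?X F p \<longleftrightarrow>
          (\<exists>x. vpair a x \<in> elts F \<and> (\<exists>y. vpair b y \<in> elts F \<and> x \<in> elts y))"
        by (cases p) auto
      show "code p = triple 1 a b \<Longrightarrow> satF ?X F p \<longleftrightarrow> (\<exists>x. vpair a x \<in> elts F \<and> vpair b x \<in> elts F)"
        by (cases p) auto
      show "code p = triple 2 a b \<Longrightarrow> satF ?X F p \<longleftrightarrow> vpair a F \<notin> elts ?S"
        using R F by (cases p) auto
      show "code p = triple 3 a b \<Longrightarrow> satF ?X F p \<longleftrightarrow> vpair a F \<in> elts ?S \<and> vpair b F \<in> elts ?S"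
        using R F by (cases p) auto
      show "code p = triple 4 a b \<Longrightarrow> satF ?X F p \<longleftrightarrow>
          (\<forall>G. elts G \<subseteq> elts ?X \<longrightarrow> sim a F G \<longrightarrow> sing a G \<longrightarrow> vpair b G \<in> elts ?S)"
        using R by (cases p) auto
      show "code p = triple 5 a b \<Longrightarrow> satF ?X F p \<longleftrightarrow>
          (\<forall>G. elts G \<subseteq> elts ?X \<longrightarrow> sim a F G \<longrightarrow> vpair b G \<in> elts ?S)"
        using R by (cases p) auto
    qed
  qed
qed

text \<open>Pairs of a code and a subset of \<open>X\<close> live three power sets above
  \<open>X\<close>, so truth over \<open>X\<close> is a subset of a set that directedness keeps
  inside \<open>V\<^sub>\<kappa>\<close>.\<close>

lemma ex_satisfaction_class:
  assumes "directed \<kappa>" "X \<in> elts (Vset \<kappa>)" "Transset X" "range code \<subseteq> elts X"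
  shows "\<exists>S\<in>elts (Vset \<kappa>). \<forall>p F. elts F \<subseteq> elts X \<longrightarrow> (vpair (code p) F \<in> elts S \<longleftrightarrow> satF X F p)"
proof -
  let ?U = "vpow (vpow (vpow X))"
  \<comment> \<open>Transitivity of \<open>X\<close> puts \<open>c\<close> next to \<open>F\<close>
    in the power set of \<open>X\<close>; the Kuratowski pair then costs two more power
    sets.\<close>
  have XU: "vpair c F \<in> elts ?U" if "c \<in> elts X" "elts F \<subseteq> elts X" for c F
    using that assms(3) unfolding Transset_def by (auto simp: elts_vpair)
  define H where "H = {z \<in> elts ?U. \<exists>p F. z = vpair (code p) F \<and> elts F \<subseteq> elts X \<and> satF X F p}"
  have "small H" unfolding H_def by (rule small_subset[OF small_elts[of ?U]]) blast
  then have H: "elts (set_of H) = H" by (rule elts_set_of)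
  have "?U \<in> elts (Vset \<kappa>)" using assms(1,2) by (intro Vset_directed_vpow)
  moreover have "elts (set_of H) \<subseteq> elts ?U" unfolding H unfolding H_def by blast
  ultimately have "set_of H \<in> elts (Vset \<kappa>)" by (rule Vset_downward)
  moreover have "vpair (code p) F \<in> H \<longleftrightarrow> satF X F p" if "elts F \<subseteq> elts X" for p F
    using XU[of "code p" F] assms(4) that unfolding H_def by (auto simp del: elts_vpow)
  ultimately show ?thesis using H by metis
qed

section \<open>Reflecting a categorical theory\<close>

lemma sat2_cong:
  "(\<And>i. i \<in> fv2 p \<Longrightarrow> e i = e' i) \<Longrightarrow> (\<And>i. i \<in> fvC2 p \<Longrightarrow> E i = E' i) \<Longrightarrow>
    sat2 M e E p \<longleftrightarrow> sat2 M e' E' p"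
proof (induction p arbitrary: e e' E E')
  case (All2 i p)
  have "sat2 M (e(i := a)) E p \<longleftrightarrow> sat2 M (e'(i := a)) E' p" for a
    by (rule All2.IH) (use All2.prems in auto)
  then show ?case by simp
next
  case (AllC2 i p)
  have "sat2 M e (E(i := A)) p \<longleftrightarrow> sat2 M e' (E'(i := A)) p" for A
    by (rule AllC2.IH) (use AllC2.prems in auto)
  then show ?case by simp
next
  case (And2 p q)
  have "sat2 M e E p \<longleftrightarrow> sat2 M e' E' p" "sat2 M e E q \<longleftrightarrow> sat2 M e' E' q"
    using And2.prems by (auto intro!: And2.IH)
  then show ?case by simp
next
  case (Neg2 p)
  have "sat2 M e E p \<longleftrightarrow> sat2 M e' E' p"
    using Neg2.prems by (auto intro!: Neg2.IH)
  then show ?case by simp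
qed simp_all

section \<open>First-order theories as second-order theories\<close>

primrec fo_to_so :: "fm \<Rightarrow> fm2" where
  "fo_to_so (Mem i j) = Mem2 i j"
| "fo_to_so (Eq i j) = Eq2 i j"
| "fo_to_so (Neg p) = Neg2 (fo_to_so p)"
| "fo_to_so (And p q) = And2 (fo_to_so p) (fo_to_so q)"
| "fo_to_so (All i p) = All2 i (fo_to_so p)"

lemma fo_to_so_fv [simp]: "fv2 (fo_to_so p) = fv p" "fvC2 (fo_to_so p) = {}"
  by (induction p) auto

lemma sat2_fo_to_so [simp]: "sat2 M e E (fo_to_so p) \<longleftrightarrow> sat M e p"
  by (induction p arbitrary: e) auto

text \<open>The translated theory has the same models among the \<open>V\<^sub>\<mu>\<close>, which
  reduces the first-order claim to the second-order one.\<close>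

lemma fo_categorical_imp_so_categorical:
  assumes "fo_theory_categorical \<kappa>" shows "so_theory_categorical \<kappa>"
proof -
  obtain T where T: "inaccessible \<kappa>" "fo_theory T" "fo_models (Vset \<kappa>) T"
      "\<forall>\<mu>. inaccessible \<mu> \<and> \<mu> \<noteq> \<kappa> \<longrightarrow> \<not> fo_models (Vset \<mu>) T"
    using assms unfolding fo_theory_categorical_def by blast
  have "so_models M (fo_to_so ` T) \<longleftrightarrow> fo_models M T" for M :: 'a
    by (simp add: so_models_def fo_models_def)
  moreover have "so_theory (fo_to_so ` T)" using T(2) by (simp add: so_theory_def fo_theory_def)
  ultimately show ?thesis using T unfolding so_theory_categorical_def by blast
qed

section \<open>The two transfers between \<open>V\<^sub>\<kappa>\<close> and
  \<open>M\<close>\<close>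

lemma not_so_theory_categorical:
  fixes \<kappa> M :: "'v::zfc"
  assumes M: "Transset M" and VM: "elts (Vset (succ \<kappa>)) \<subseteq> elts M" and elem: "elem_substructure (Vset \<kappa>) M"
  shows "\<not> so_theory_categorical \<kappa>"
proof
  assume "so_theory_categorical \<kappa>"
  then obtain T where \<kappa>: "inaccessible \<kappa>" and T: "so_theory T" "so_models (Vset \<kappa>) T"
    and uniq: "\<And>\<mu>. inaccessible \<mu> \<Longrightarrow> \<mu> \<noteq> \<kappa> \<Longrightarrow> \<not> so_models (Vset \<mu>) T"
    unfolding so_theory_categorical_def by blast
  let ?V = "Vset \<kappa>"
  \<comment> \<open>Truth of sentences may be tested at one assignment: all individuals zero, all
    classes empty. Its code \<open>F0\<close> is a subset of every inaccessible level, so it can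
    serve as a parameter.\<close>
  define e0 :: "nat \<Rightarrow> 'v" where "e0 = (\<lambda>_. vnat 0)"
  define E0 :: "nat \<Rightarrow> 'v set" where "E0 = (\<lambda>_. {})"
  define F0 :: 'v where "F0 = set_of (range (\<lambda>n. vpair (ivar n) (vnat 0)))"
  have F0: "elts F0 = range (\<lambda>n. vpair (ivar n) (vnat 0))"
    unfolding F0_def by (rule elts_set_of[OF small_range_nat])
  have F0V: "elts F0 \<subseteq> elts (Vset \<delta>)" if "inaccessible \<delta>" for \<delta>
    unfolding F0 using that by (auto intro!: Vset_directed_vpair inaccessible_directed var_in_Vset vnat_in_Vset)
  have codes0: "codes F0 e0 E0" unfolding codes_def F0 e0_def E0_def by auto
  have sent: "sat2 (Vset \<delta>) e E p \<longleftrightarrow> satF (Vset \<delta>) F0 p" if "inaccessible \<delta>" "p \<in> T" for \<delta> e E p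
  proof -
    have "sat2 (Vset \<delta>) e E p \<longleftrightarrow> sat2 (Vset \<delta>) e0 E0 p"
      using T(1) that(2) unfolding so_theory_def by (intro sat2_cong) auto
    then show ?thesis using satF_iff_sat2[OF that(1) F0V[OF that(1)] codes0] by simp
  qed
  have models: "so_models (Vset \<delta>) T \<longleftrightarrow> (\<forall>p\<in>T. satF (Vset \<delta>) F0 p)" if "inaccessible \<delta>" for \<delta>
    using sent[OF that] unfolding so_models_def by blast
  define N :: 'v where "N = set_of (range code)"
  \<comment> \<open>There are only countably many formulas, so the theory itself is coded by an
    element of \<open>V\<^sub>\<kappa>\<close>.\<close>
  define t :: 'v where "t = set_of (code ` T)"
  have cN: "countable (range (code :: fm2 \<Rightarrow> 'v))" by simp
  have ct: "countable (code ` T :: 'v set)" by (rule countable_subset[OF _ cN]) auto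
  have N: "elts N = range code" unfolding N_def by (rule elts_set_of[OF small_countable[OF cN]])
  have t: "elts t = code ` T" unfolding t_def by (rule elts_set_of[OF small_countable[OF ct]])
  have NV: "elts N \<subseteq> elts (Vset \<delta>)" if "inaccessible \<delta>" for \<delta>
    unfolding N using code_in_Vset[OF that] by blast
  have "infinite (range (code :: fm2 \<Rightarrow> 'v))"
  proof -
    have "inj (\<lambda>n. code (Eq2 n n) :: 'v)" by (simp add: inj_def)
    then have "infinite (range (\<lambda>n. code (Eq2 n n) :: 'v))" by (rule range_inj_infinite)
    then show ?thesis by (rule infinite_super[rotated]) (intro image_subsetI rangeI)
  qed
  then have Ninf: "countable (elts N)" "infinite (elts N)" using cN N by auto
  \<comment> \<open>The parameters sit at 23, 24 and 25 and the tags from 30 on; truncated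
    subtraction gives variables below 30 the harmless default zero.\<close>
  define e :: "nat \<Rightarrow> 'v" where "e = (\<lambda>i. if i = 23 then N else if i = 24 then t else if i = 25 then F0 else vnat (i - 30))"
  have F0in: "F0 \<in> elts ?V"
    unfolding F0_def using F0V[OF \<kappa>] F0 by (intro Vset_inaccessible_countable[OF \<kappa>]) auto
  have Nin: "N \<in> elts ?V"
    unfolding N_def using NV[OF \<kappa>] N cN by (intro Vset_inaccessible_countable[OF \<kappa>]) auto
  have tin: "t \<in> elts ?V"
    using Nin by (rule Vset_downward) (auto simp: N t)
  have eV: "e i \<in> elts ?V" for i unfolding e_def using F0in Nin tin vnat_in_Vset[OF \<kappa>] by auto
  have envV: "env ?V e" unfolding env_def using eV Transset_Vset by blast
  have envM: "env M e" unfolding env_def using eV M elem unfolding elem_substructure_def by blast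
  have transfer: "sat ?V e p \<longleftrightarrow> sat M e p" for p
    using elem eV unfolding elem_substructure_def by blast
  have PV: "pow_closed ?V X" if "X \<in> elts ?V" for X
    unfolding pow_closed_def using Vset_downward[OF that] by blast
  \<comment> \<open>Here \<open>V\<^sub>\<kappa>\<^sub>+\<^sub>1 \<subseteq> M\<close> enters: each
    subset of \<open>V\<^sub>\<kappa>\<close> belongs to the next level.\<close>
  have PM: "pow_closed M ?V"
    unfolding pow_closed_def using VM by (auto intro!: subsetD[OF VM] VsetI[of \<kappa>] simp: elts_succ)
  have \<kappa>M: "?V \<in> elts M" "\<kappa> \<in> elts M"
    using PM elts_subset_Vset unfolding pow_closed_def by blast+
  have tags: "(e(20 := \<delta>, 21 := X, 22 := S)) (30 + k) = vnat k" for \<delta> X S k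
    by (simp add: e_def)
  \<comment> \<open>\<open>A\<close> will be \<open>V\<^sub>\<kappa>\<close> as well as
    \<open>M\<close>; in both, the formula expresses true inaccessibility.\<close>
  have inacc: "sat A (e(20 := \<delta>, 21 := X)) fInacc \<longleftrightarrow> inaccessible \<delta> \<and> X = Vset \<delta>"
    "sat A (e(20 := \<delta>, 21 := X, 22 := S)) fInacc \<longleftrightarrow> inaccessible \<delta> \<and> X = Vset \<delta>"
    if "env A e" "\<delta> \<in> elts A" "X \<in> elts A" "S \<in> elts A" "pow_closed A X" for A \<delta> X S
    using sat_fInacc[of A "e(20 := \<delta>, 21 := X)"] sat_fInacc[of A "e(20 := \<delta>, 21 := X, 22 := S)"]
      that Ninf NV by (simp_all add: e_def)
  have satc: "sat A (e(20 := \<delta>, 21 := X, 22 := S)) fSat \<longleftrightarrow>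
      (\<forall>p F. elts F \<subseteq> elts X \<longrightarrow> (vpair (code p) F \<in> elts S \<longleftrightarrow> satF X F p))"
    if "env A e" "\<delta> \<in> elts A" "X \<in> elts A" "S \<in> elts A" "pow_closed A X" for A \<delta> X S
  proof -
    have "env A (e(20 := \<delta>, 21 := X, 22 := S))" using that by simp
    moreover have "(e(20 := \<delta>, 21 := X, 22 := S)) 23 = N" by (simp add: e_def)
    ultimately show ?thesis
      using sat_fSat[of A "e(20 := \<delta>, 21 := X, 22 := S)"] tags that(5) N by simp
  qed
  \<comment> \<open>Upward transfer: every inaccessible level that is an element of
    \<open>V\<^sub>\<kappa>\<close> has a satisfaction class there. In \<open>M\<close> this applies
    to \<open>V\<^sub>\<kappa>\<close> itself and produces \<open>S\<close>.\<close>
  have "sat ?V e (All 20 (All 21 (fImp fInacc (fEx 22 fSat))))"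
  proof -
    have "\<exists>S\<in>elts ?V. sat ?V (e(20 := \<delta>, 21 := X, 22 := S)) fSat"
      if "\<delta> \<in> elts ?V" and X: "X \<in> elts ?V" and i: "sat ?V (e(20 := \<delta>, 21 := X)) fInacc" for \<delta> X
    proof -
      have \<delta>: "inaccessible \<delta>" and XV: "X = Vset \<delta>"
        using inacc(1)[OF envV that(1) X X PV[OF X]] i by auto
      have "\<exists>S\<in>elts ?V. \<forall>p F. elts F \<subseteq> elts X \<longrightarrow> (vpair (code p) F \<in> elts S \<longleftrightarrow> satF X F p)"
      proof (rule ex_satisfaction_class[OF inaccessible_directed[OF \<kappa>] X])
        show "Transset X" unfolding XV by (rule Transset_Vset)
        show "range code \<subseteq> elts X" using NV[OF \<delta>] unfolding XV N .
      qed
      then show ?thesis using satc[OF envV that(1) X _ PV[OF X]] by blast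
    qed
    then show ?thesis by simp
  qed
  then have "sat M e (All 20 (All 21 (fImp fInacc (fEx 22 fSat))))"
    unfolding transfer .
  then have "\<exists>S\<in>elts M. sat M (e(20 := \<kappa>, 21 := ?V, 22 := S)) fSat"
    using \<kappa>M inacc(1)[OF envM \<kappa>M(2,1,1) PM] \<kappa> by simp
  then obtain S where S: "S \<in> elts M" "sat M (e(20 := \<kappa>, 21 := ?V, 22 := S)) fSat" by blast
  \<comment> \<open>Besides fixing 20, 21 and 22, this says that the class 22 holds of each code in
    the theory 24 at the assignment \<open>F0\<close>.\<close>
  define Q where "Q = And fInacc (And fSat (All 26 (fImp (Mem 26 24) (fIn 26 25 22))))"
  have Q: "sat A (e(20 := \<delta>, 21 := X, 22 := S)) Q \<longleftrightarrow> inaccessible \<delta> \<and> X = Vset \<delta> \<and>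
      sat A (e(20 := \<delta>, 21 := X, 22 := S)) fSat \<and> so_models X T"
    if A: "env A e" "\<delta> \<in> elts A" "X \<in> elts A" "S \<in> elts A" "pow_closed A X" for A \<delta> X S
  proof -
    have "sat A (e(20 := \<delta>, 21 := X, 22 := S)) (All 26 (fImp (Mem 26 24) (fIn 26 25 22))) \<longleftrightarrow>
        (\<forall>c\<in>elts A. c \<in> elts (e 24) \<longrightarrow> vpair c F0 \<in> elts S)"
      using A by (simp add: e_def cong: ball_cong)
    also have "\<dots> \<longleftrightarrow> (\<forall>p\<in>T. vpair (code p) F0 \<in> elts S)"
      unfolding env_bounded[OF A(1)] by (simp add: e_def t)
    finally have *: "sat A (e(20 := \<delta>, 21 := X, 22 := S)) (All 26 (fImp (Mem 26 24) (fIn 26 25 22))) \<longleftrightarrow> \<dots>" .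
    show ?thesis
      unfolding Q_def sat.simps(4) inacc(2)[OF A] * satc[OF A]
      using F0V models by auto
  qed
  \<comment> \<open>Downward transfer: \<kappa>, \<open>V\<^sub>\<kappa>\<close> and
    \<open>S\<close> are witnesses in \<open>M\<close>, so \<open>V\<^sub>\<kappa>\<close> has
    witnesses of its own.\<close>
  have "sat M e (fEx 20 (fEx 21 (fEx 22 Q)))"
    using Q[OF envM \<kappa>M(2,1) S(1) PM] \<kappa> T(2) S \<kappa>M by auto
  then have "sat ?V e (fEx 20 (fEx 21 (fEx 22 Q)))" unfolding transfer .
  then obtain \<delta> X S' where X: "\<delta> \<in> elts ?V" "X \<in> elts ?V" "S' \<in> elts ?V"
      "sat ?V (e(20 := \<delta>, 21 := X, 22 := S')) Q"
    by auto
  then have "inaccessible \<delta>" "X = Vset \<delta>" "so_models X T"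
    using Q[OF envV X(1-3) PV[OF X(2)]] by auto
  \<comment> \<open>Otherwise \<open>V\<^sub>\<kappa>\<close> would be an element of itself.\<close>
  moreover have "\<delta> \<noteq> \<kappa>" using X(2) calculation(2) elts_irrefl by blast
  ultimately show False using uniq by blast
qed

theorem theorem12:
  fixes \<kappa> M :: "'v::zfc"
  assumes "Card \<kappa>"
    and "Transset M"
    and "elts (Vset (succ \<kappa>)) \<subseteq> elts M"
    and "elem_substructure (Vset \<kappa>) M"
  shows "\<not> fo_theory_categorical \<kappa> \<and> \<not> so_theory_categorical \<kappa>"
  using not_so_theory_categorical[OF assms(2-4)] fo_categorical_imp_so_categorical by blast

end
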